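(* Consider the planar system $\dot x=y+P(x,y)$, $\dot y=Q(x,y)$, with $j^1P(0)=j^1Q(0)=0$, having at the origin a monodromic singular point satisfying the monodromy condition $\beta=n-1$ (of the $C^r$ version of Andreev's monodromy criterion, recalled in the context). Then the system cannot admit a formal first integral.
   Context: $j^lG(0)$ denotes the $l$-jet (Taylor polynomial of degree $l$) of $G$ at $0$. The system is not assumed analytic. The $C^r$ version of Andreev's criterion is the following. Let $P,Q$ be of class $C^r$, $r\geqslant 3$, with the origin an isolated singular point. Let $y=F(x)$ be the solution of $y+P(x,y)=0$ through $(0,0)$, $f(x)=Q(x,F(x))$, and $\Phi(x)=(\partial_xP+\partial_yQ)(x,F(x))$ (the divergence of the vector field along $y=F(x)$). Write $f(x)=ax^{\alpha}+O(x^{\alpha+1})$ with $\alpha<r$ and $a\neq 0$, and $\Phi(x)=bx^{\beta}+O(x^{\beta+1})$, with $b\neq0$ when $j^r\Phi(0)\not\equiv 0$. Then the origin is monodromic (orbits turn around it and a first return map is defined) if and only if $a<0$, $\alpha=2n-1$ for a positive integer $n$, and one of the following holds: (i) $\beta>n-1$ or $j^r\Phi(0)\equiv 0$; (ii) $\beta=n-1$ and $b^2+4an<0$. "The monodromy condition $\beta=n-1$" is condition (ii). A formal first integral is a nonconstant formal power series $H(x,y)$ such that $(y+P)\,\partial_xH+Q\,\partial_yH=0$ as formal power series, where $P$ and $Q$ are replaced by their Taylor series at the origin. *)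

theory Defs
  imports
    "HOL-Analysis.Analysis"
    "HOL-Library.Landau_Symbols"
    "HOL-Computational_Algebra.Formal_Power_Series"
begin

section \<open>Smooth functions of two variables and their Taylor series\<close>

definition pd_x :: "(real \<times> real \<Rightarrow> real) \<Rightarrow> real \<times> real \<Rightarrow> real" where
  "pd_x G = (\<lambda>(x, y). deriv (\<lambda>t. G (t, y)) x)"

definition pd_y :: "(real \<times> real \<Rightarrow> real) \<Rightarrow> real \<times> real \<Rightarrow> real" where
  "pd_y G = (\<lambda>(x, y). deriv (\<lambda>t. G (x, t)) y)"

text \<open>Class \<open>C\<^sup>k\<close>; only meant for open \<open>U\<close>.\<close>

fun Ck_on :: "nat \<Rightarrow> (real \<times> real \<Rightarrow> real) \<Rightarrow> (real \<times> real) set \<Rightarrow> bool" where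
  "Ck_on 0 G U \<longleftrightarrow> continuous_on U G"
| "Ck_on (Suc k) G U \<longleftrightarrow> G differentiable_on U \<and> Ck_on k (pd_x G) U \<and> Ck_on k (pd_y G) U"

definition smooth_near_origin :: "(real \<times> real \<Rightarrow> real) \<Rightarrow> bool" where
  "smooth_near_origin G \<longleftrightarrow> (\<exists>U. open U \<and> (0, 0) \<in> U \<and> (\<forall>k. Ck_on k G U))"

text \<open>
  Formal power series in \<open>x, y\<close> are represented as series in \<open>x\<close> whose coefficients are series
  in \<open>y\<close>: the coefficient of \<open>x\<^sup>i y\<^sup>j\<close> in \<open>H\<close> is \<open>fps_nth (fps_nth H i) j\<close>.
\<close>

definition taylor_series :: "(real \<times> real \<Rightarrow> real) \<Rightarrow> real fps fps" where
  "taylor_series G =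
     Abs_fps (\<lambda>i. Abs_fps (\<lambda>j. (pd_x ^^ i) ((pd_y ^^ j) G) (0, 0) / (fact i * fact j)))"

definition jet :: "nat \<Rightarrow> (real \<times> real \<Rightarrow> real) \<Rightarrow> real fps fps" where
  "jet l G = Abs_fps (\<lambda>i. Abs_fps (\<lambda>j. if i + j \<le> l then fps_nth (fps_nth (taylor_series G) i) j else 0))"

definition fps_y :: "real fps fps" where
  "fps_y = fps_const fps_X"

definition fps_dx :: "real fps fps \<Rightarrow> real fps fps" where
  "fps_dx H = fps_deriv H"

definition fps_dy :: "real fps fps \<Rightarrow> real fps fps" where
  "fps_dy H = Abs_fps (\<lambda>i. fps_deriv (fps_nth H i))"

section \<open>The system \<open>x' = y + P(x, y), y' = Q(x, y)\<close>\<close>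

definition nilp_field ::
  "(real \<times> real \<Rightarrow> real) \<Rightarrow> (real \<times> real \<Rightarrow> real) \<Rightarrow> real \<times> real \<Rightarrow> real \<times> real" where
  "nilp_field P Q = (\<lambda>(x, y). (y + P (x, y), Q (x, y)))"

definition formal_first_integral ::
  "(real \<times> real \<Rightarrow> real) \<Rightarrow> (real \<times> real \<Rightarrow> real) \<Rightarrow> real fps fps \<Rightarrow> bool" where
  "formal_first_integral P Q H \<longleftrightarrow>
     (\<forall>c. H \<noteq> fps_const (fps_const c)) \<and>
     (fps_y + taylor_series P) * fps_dx H + taylor_series Q * fps_dy H = 0"

definition isolated_singular_origin :: "(real \<times> real \<Rightarrow> real \<times> real) \<Rightarrow> bool" where
  "isolated_singular_origin X \<longleftrightarrow>
     X (0, 0) = (0, 0) \<and> (\<forall>\<^sub>F z in at (0, 0). X z \<noteq> (0, 0))"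

text \<open>
  The orbit of every point near the origin makes a complete turn around the origin, staying close
  to it; \<open>\<theta>\<close> is a continuous polar angle along the orbit. Since the angle changes by exactly
  \<open>2 * pi\<close>, the orbit is back at time \<open>T\<close> on the half-line from the origin on which it started;
  taking the first such time defines the first return map on any half-line.
\<close>

definition monodromic_origin :: "(real \<times> real \<Rightarrow> real \<times> real) \<Rightarrow> bool" where
  "monodromic_origin X \<longleftrightarrow>
     (\<forall>\<epsilon>>0. \<exists>\<delta>>0. \<forall>p \<in> ball (0, 0) \<delta> - {(0, 0)}. \<exists>T>0. \<exists>\<gamma> \<theta>.
        \<gamma> 0 = p \<and>
        (\<forall>t\<in>{0..T}. (\<gamma> has_vector_derivative X (\<gamma> t)) (at t within {0..T})) \<and>
        (\<forall>t\<in>{0..T}. \<gamma> t \<in> ball (0, 0) \<epsilon> - {(0, 0)}) \<and>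
        continuous_on {0..T} \<theta> \<and>
        (\<forall>t\<in>{0..T}. \<gamma> t = (norm (\<gamma> t) * cos (\<theta> t), norm (\<gamma> t) * sin (\<theta> t))) \<and>
        \<bar>\<theta> T - \<theta> 0\<bar> = 2 * pi)"

section \<open>The data of Andreev's criterion\<close>

text \<open>By the implicit function theorem, the germ of such an \<open>F\<close> at \<open>0\<close> exists, is unique and is
  as smooth as \<open>P\<close>.\<close>

definition nullcline_branch :: "(real \<times> real \<Rightarrow> real) \<Rightarrow> (real \<Rightarrow> real) \<Rightarrow> bool" where
  "nullcline_branch P F \<longleftrightarrow>
     F 0 = 0 \<and> isCont F 0 \<and> (\<forall>\<^sub>F x in nhds 0. F x + P (x, F x) = 0)"

definition divergence_along ::
  "(real \<times> real \<Rightarrow> real) \<Rightarrow> (real \<times> real \<Rightarrow> real) \<Rightarrow> (real \<Rightarrow> real) \<Rightarrow> real \<Rightarrow> real" where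
  "divergence_along P Q F x = pd_x P (x, F x) + pd_y Q (x, F x)"

definition has_leading_term :: "(real \<Rightarrow> real) \<Rightarrow> real \<Rightarrow> nat \<Rightarrow> bool" where
  "has_leading_term g c m \<longleftrightarrow> c \<noteq> 0 \<and> (\<lambda>x. g x - c * x ^ m) \<in> O[at 0](\<lambda>x. x ^ (m + 1))"

text \<open>
  Monodromy condition \<open>\<beta> = n - 1\<close>. For \<open>P, Q\<close> of class \<open>C\<^sup>\<infinity>\<close> the bound \<open>\<alpha> < r\<close> on the order
  of the first term is void. The divergence has a nonzero leading coefficient \<open>b\<close>: otherwise its
  jet vanishes, which is a different case of the criterion.
\<close>

definition andreev_condition_ii ::
  "(real \<times> real \<Rightarrow> real) \<Rightarrow> (real \<times> real \<Rightarrow> real) \<Rightarrow> bool" where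
  "andreev_condition_ii P Q \<longleftrightarrow>
     (\<exists>F a b \<alpha> \<beta> n.
        nullcline_branch P F \<and>
        has_leading_term (\<lambda>x. Q (x, F x)) a \<alpha> \<and>
        has_leading_term (divergence_along P Q F) b \<beta> \<and>
        a < 0 \<and> n \<ge> 1 \<and> \<alpha> = 2 * n - 1 \<and> \<beta> = n - 1 \<and>
        b\<^sup>2 + 4 * a * real n < 0)"

end

theory Submission
  imports Defs
begin

text \<open>
  Let \<open>\<phi>\<close> be the Taylor series of the branch \<open>F\<close> of \<open>y + P(x, y) = 0\<close>, and put
  \<open>x = s\<close>, \<open>y = \<phi>(s) + \<tau> s\<^sup>n\<close> with a real parameter \<open>\<tau>\<close>. For a formal first integral \<open>H\<close>,
  let \<open>g\<^sub>\<tau>(s)\<close> be the result of this substitution. The equation for \<open>H\<close> becomes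
  \<open>A\<^sub>1 s \<partial>\<^sub>s g + (C\<^sub>1 - n \<tau> A\<^sub>1) \<partial>\<^sub>\<tau> g = 0\<close>, where \<open>A\<^sub>1 = \<tau> + O(s)\<close> and \<open>C\<^sub>1 = a + b \<tau> + O(s)\<close>;
  the coefficient of \<open>\<tau>\<close> in \<open>C\<^sub>1\<close> comes from the divergence. Hence the first nonvanishing
  coefficient of \<open>g\<close> of positive order, say of \<open>s\<^sup>d\<close>, is a polynomial \<open>p(\<tau>) \<noteq> 0\<close> with
  \<open>(n \<tau>\<^sup>2 - b \<tau> - a) p' = d \<tau> p\<close>. If \<open>\<lambda>\<close> is a nonreal root of the quadratic factor, the
  order \<open>m\<close> of \<open>p\<close> at \<open>\<lambda>\<close> satisfies \<open>m n (\<lambda> - cnj \<lambda>) = d \<lambda>\<close>. The left-hand side is imaginary, so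
  \<open>Re \<lambda> = b / (2 n)\<close> would vanish, contrary to \<open>b \<noteq> 0\<close>.
\<close>

section \<open>Substitution into formal power series in two variables\<close>

text \<open>The substitution \<open>x = s\<close> into a series in \<open>x\<close> whose coefficients are series in \<open>s\<close>.\<close>

definition fps_diag :: "'a::comm_ring_1 fps fps \<Rightarrow> 'a fps" where
  "fps_diag U = Abs_fps (\<lambda>k. \<Sum>i\<le>k. fps_nth (fps_nth U i) (k - i))"

lemma fps_diag_nth: "fps_nth (fps_diag U) k = (\<Sum>i\<le>k. fps_nth (fps_nth U i) (k - i))"
  by (simp add: fps_diag_def)

lemma fps_diag_add: "fps_diag (U + V) = fps_diag U + fps_diag V"
  by (rule fps_ext) (simp add: fps_diag_nth sum.distrib)

lemma fps_diag_const: "fps_diag (fps_const W) = W"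
proof (rule fps_ext)
  fix k
  have "(\<Sum>i\<le>k. fps_nth (fps_nth (fps_const W) i) (k - i)) = (\<Sum>i\<le>k. if i = 0 then fps_nth W k else 0)"
    by (rule sum.cong) auto
  then show "fps_nth (fps_diag (fps_const W)) k = fps_nth W k"
    by (simp add: fps_diag_nth)
qed

text \<open>Both sides sum the same products over index quadruples of total \<open>k\<close>: the
  left groups them by joint \<open>x\<close>-degree, the right by the total degree of the factor
  from \<open>U\<close>.\<close>

lemma fps_diag_mult: "fps_diag (U * V) = fps_diag U * fps_diag V"
proof (rule fps_ext)
  fix k :: nat
  let ?L = "SIGMA i:{..k}. SIGMA a:{0..i}. {0..k-i}"
  let ?R = "SIGMA m:{0..k}. SIGMA a:{..m}. {..k-m}"
  have "fps_nth (fps_diag (U * V)) k =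
      (\<Sum>(i, a, c)\<in>?L. fps_nth (fps_nth U a) c * fps_nth (fps_nth V (i - a)) (k - i - c))"
    by (simp add: fps_diag_nth fps_mult_nth fps_sum_nth sum.Sigma)
  also have "\<dots> = (\<Sum>(m, a, b)\<in>?R. fps_nth (fps_nth U a) (m - a) * fps_nth (fps_nth V b) (k - m - b))"
    by (rule sum.reindex_bij_witness[of _ "\<lambda>(m, a, b). (a + b, a, m - a)" "\<lambda>(i, a, c). (a + c, a, i - a)"])
      (auto simp: diff_diff_left add.commute add.left_commute split: prod.splits)
  also have "\<dots> = fps_nth (fps_diag U * fps_diag V) k"
    by (simp add: fps_diag_nth fps_mult_nth sum_product sum.Sigma)
  finally show "fps_nth (fps_diag (U * V)) k = fps_nth (fps_diag U * fps_diag V) k" .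
qed

text \<open>Chain rule along the diagonal; it comes from splitting the weight \<open>Suc k\<close>
  into \<open>i\<close> and \<open>Suc k - i\<close>.\<close>

lemma fps_deriv_diag:
  "fps_deriv (fps_diag U) = fps_diag (fps_deriv U) + fps_diag (Abs_fps (\<lambda>i. fps_deriv (fps_nth U i)))"
proof (rule fps_ext)
  fix k
  \<comment> \<open>The ranges extend to \<open>Suc k\<close> because the added terms,
    \<open>i = 0\<close> here and \<open>i = Suc k\<close> in \<open>2\<close>, carry weight
    zero.\<close>
  have 1: "(\<Sum>i\<le>k. of_nat (Suc i) * fps_nth (fps_nth U (Suc i)) (k - i))
      = (\<Sum>i\<le>Suc k. of_nat i * fps_nth (fps_nth U i) (Suc k - i))"
    by (subst sum.atMost_Suc_shift) simp
  have 2: "(\<Sum>i\<le>k. of_nat (Suc (k - i)) * fps_nth (fps_nth U i) (Suc (k - i)))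
      = (\<Sum>i\<le>Suc k. of_nat (Suc k - i) * fps_nth (fps_nth U i) (Suc k - i))"
    by (simp add: Suc_diff_le del: of_nat_Suc of_nat_diff)
  have "of_nat (Suc k) * fps_nth (fps_nth U i) (Suc k - i)
      = of_nat i * fps_nth (fps_nth U i) (Suc k - i) + of_nat (Suc k - i) * fps_nth (fps_nth U i) (Suc k - i)"
    if "i \<le> Suc k" for i
    using that by (metis add.commute le_add_diff_inverse2 of_nat_add distrib_right)
  then have 3: "of_nat (Suc k) * (\<Sum>i\<le>Suc k. fps_nth (fps_nth U i) (Suc k - i)) =
      (\<Sum>i\<le>Suc k. of_nat i * fps_nth (fps_nth U i) (Suc k - i)) +
      (\<Sum>i\<le>Suc k. of_nat (Suc k - i) * fps_nth (fps_nth U i) (Suc k - i))"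
    unfolding sum_distrib_left sum.distrib[symmetric] by (intro sum.cong) auto
  have 4: "fps_nth (fps_nth (fps_deriv U) i) j = of_nat (Suc i) * fps_nth (fps_nth U (Suc i)) j" for i j
    by (simp only: fps_deriv_nth Suc_eq_plus1[symmetric] fps_of_nat[symmetric] fps_mult_left_const_nth)
  show "fps_nth (fps_deriv (fps_diag U)) k = fps_nth (fps_diag (fps_deriv U)
      + fps_diag (Abs_fps (\<lambda>i. fps_deriv (fps_nth U i)))) k"
    unfolding fps_add_nth fps_diag_nth fps_deriv_nth[of "fps_diag U"] fps_nth_Abs_fps 4 fps_deriv_nth[of "fps_nth U _"] Suc_eq_plus1[symmetric] 1 2 3 ..
qed

text \<open>\<open>H(s, Y(s))\<close>; only meaningful if \<open>Y\<close> has no constant term.\<close>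

definition fps_subst :: "'a::idom fps fps \<Rightarrow> 'a fps \<Rightarrow> 'a fps" where
  "fps_subst H Y = fps_diag (Abs_fps (\<lambda>i. fps_nth H i oo Y))"

lemma fps_subst_0 [simp]: "fps_subst 0 Y = 0"
  by (rule fps_ext) (simp add: fps_subst_def fps_diag_nth)

lemma fps_subst_add: "fps_subst (G + H) Y = fps_subst G Y + fps_subst H Y"
  unfolding fps_subst_def fps_diag_add[symmetric]
  by (rule arg_cong[of _ _ fps_diag], rule fps_ext) (simp add: fps_compose_add_distrib)

lemma fps_subst_mult:
  assumes "fps_nth Y 0 = 0"
  shows "fps_subst (G * H) Y = fps_subst G Y * fps_subst H Y"
  unfolding fps_subst_def fps_diag_mult[symmetric]
  by (rule arg_cong[of _ _ fps_diag], rule fps_ext)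
    (simp add: fps_mult_nth fps_compose_sum_distrib fps_compose_mult_distrib[OF assms])

lemma fps_subst_y:
  assumes "fps_nth Y 0 = 0"
  shows "fps_subst fps_y Y = Y"
proof -
  have "Abs_fps (\<lambda>i. fps_nth fps_y i oo Y) = fps_const Y"
    by (rule fps_ext) (simp add: fps_y_def fps_X_fps_compose_startby0[OF assms])
  then show ?thesis by (simp add: fps_subst_def fps_diag_const)
qed

text \<open>Composing the coefficients with \<open>Y\<close> commutes with the
  \<open>x\<close>-derivative, while differentiating the composed coefficients brings out the factor
  \<open>fps_deriv Y\<close>.\<close>

lemma fps_deriv_subst:
  assumes "fps_nth Y 0 = (0::real)"
  shows "fps_deriv (fps_subst H Y) = fps_subst (fps_dx H) Y + fps_subst (fps_dy H) Y * fps_deriv Y"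
proof -
  have "fps_nth (fps_deriv H) i oo Y = fps_nth (fps_deriv (Abs_fps (\<lambda>i. fps_nth H i oo Y))) i" for i
    by (simp add: fps_compose_mult_distrib[OF assms] fps_of_nat[symmetric] del: fps_of_nat of_nat_Suc of_nat_add)
  then have 1: "Abs_fps (\<lambda>i. fps_nth (fps_dx H) i oo Y) = fps_deriv (Abs_fps (\<lambda>i. fps_nth H i oo Y))"
    by (intro fps_ext) (simp only: fps_dx_def fps_nth_Abs_fps)
  have 2: "Abs_fps (\<lambda>i. fps_deriv (fps_nth (Abs_fps (\<lambda>i. fps_nth H i oo Y)) i))
     = Abs_fps (\<lambda>i. fps_nth (fps_dy H) i oo Y) * fps_const (fps_deriv Y)"
    by (rule fps_ext) (simp add: fps_dy_def fps_compose_deriv[OF assms])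
  show ?thesis
    unfolding fps_subst_def fps_deriv_diag 1 2 fps_diag_mult fps_diag_const ..
qed

lemma fps_subst_nth:
  "fps_nth (fps_subst H Y) k = (\<Sum>i\<le>k. \<Sum>j\<le>k-i. fps_nth (fps_nth H i) j * fps_nth (Y ^ j) (k - i))"
  by (simp add: fps_subst_def fps_diag_nth fps_compose_nth atLeast0AtMost)

lemma fps_subst_nth_0: "fps_nth (fps_subst H Y) 0 = fps_nth (fps_nth H 0) 0"
  by (simp add: fps_subst_nth)

section \<open>Dependence of the substituted series on the parameter\<close>

lemma has_field_derivative_fps_power_nth:
  fixes \<phi> u :: "real fps"
  shows "((\<lambda>\<tau>. fps_nth ((\<phi> + fps_const \<tau> * u) ^ j) m) has_field_derivative
    fps_nth (of_nat j * (\<phi> + fps_const \<tau> * u) ^ (j - 1) * u) m) (at \<tau>)"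
proof (induction j arbitrary: m)
  case 0
  then show ?case by simp
next
  case (Suc j)
  let ?Y = "\<lambda>\<tau>. \<phi> + fps_const \<tau> * u"
  have Y: "((\<lambda>\<tau>. fps_nth (?Y \<tau>) k) has_field_derivative fps_nth u k) (at \<tau>)" for k
    by (auto intro!: derivative_eq_intros)
  have "of_nat (Suc j) * ?Y \<tau> ^ (Suc j - 1) * u = u * ?Y \<tau> ^ j + ?Y \<tau> * (of_nat j * ?Y \<tau> ^ (j - 1) * u)"
    by (cases j) (simp_all add: algebra_simps)
  then have eq: "fps_nth (of_nat (Suc j) * ?Y \<tau> ^ (Suc j - 1) * u) m =
     (\<Sum>i=0..m. fps_nth u i * fps_nth (?Y \<tau> ^ j) (m - i) + fps_nth (?Y \<tau>) i * fps_nth (of_nat j * ?Y \<tau> ^ (j - 1) * u) (m - i))"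
    by (simp add: fps_mult_nth[of u] fps_mult_nth[of "?Y \<tau>"] sum.distrib del: of_nat_Suc)
  show ?case
    unfolding eq power_Suc fps_mult_nth[of "?Y _" "?Y _ ^ _"]
    by (intro DERIV_sum) (subst add.commute, rule DERIV_mult'[OF Y Suc.IH])
qed

text \<open>For \<open>j > 0\<close> the series \<open>Y ^ (j - 1) * u\<close> has order at least
  \<open>j\<close>, so the sum stops at \<open>m\<close>. In this form it matches, term by term, the
  parameter derivative of a coefficient of \<open>a oo Y\<close>.\<close>

lemma fps_compose_deriv_mult_nth:
  fixes a Y u :: "real fps"
  assumes "fps_nth Y 0 = 0" "fps_nth u 0 = 0"
  shows "fps_nth ((fps_deriv a oo Y) * u) m = (\<Sum>j\<le>m. fps_nth a j * fps_nth (of_nat j * Y ^ (j - 1) * u) m)"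
proof -
  have 0: "fps_nth (Y ^ j) l = 0" if "l < j" for j l
    using assms(1) startsby_zero_power_prefix that by blast
  have 1: "fps_nth (fps_deriv a oo Y) l = (\<Sum>j\<le>m. fps_nth (fps_deriv a) j * fps_nth (Y ^ j) l)" if "l \<le> m" for l
    unfolding fps_compose_nth using that by (intro sum.mono_neutral_left) (auto simp: 0)
  \<comment> \<open>The index shift below creates one extra term, \<open>j = Suc m\<close>; it
    contains \<open>Y ^ m * u\<close>, whose order exceeds \<open>m\<close>.\<close>
  have z: "fps_nth (Y ^ m * u) m = 0"
    unfolding fps_mult_nth
  proof (rule sum.neutral, intro ballI)
    fix i assume "i \<in> {0..m}"
    then show "fps_nth (Y ^ m) i * fps_nth u (m - i) = 0"
      using 0[of i m] assms(2) by (cases "i = m") auto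
  qed
  have "fps_nth ((fps_deriv a oo Y) * u) m = (\<Sum>l=0..m. \<Sum>j\<le>m. fps_nth (fps_deriv a) j * fps_nth (Y ^ j) l * fps_nth u (m - l))"
    unfolding fps_mult_nth by (intro sum.cong refl) (simp add: 1 sum_distrib_right)
  also have "\<dots> = (\<Sum>j\<le>m. fps_nth (fps_deriv a) j * fps_nth (Y ^ j * u) m)"
    unfolding fps_mult_nth by (subst sum.swap) (simp add: sum_distrib_left mult.assoc)
  also have "\<dots> = (\<Sum>j\<le>Suc m. fps_nth a j * (of_nat j * fps_nth (Y ^ (j - 1) * u) m))"
    by (subst sum.atMost_Suc_shift) (simp add: algebra_simps)
  also have "\<dots> = (\<Sum>j\<le>m. fps_nth a j * (of_nat j * fps_nth (Y ^ (j - 1) * u) m))"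
    using z by simp
  finally show ?thesis
    by (simp add: mult.assoc fps_of_nat[symmetric] del: fps_of_nat)
qed

lemma fps_subst_mult_nth:
  "fps_nth (fps_subst H Y * u) k = (\<Sum>i\<le>k. fps_nth ((fps_nth H i oo Y) * u) (k - i))"
proof -
  have "fps_subst H Y * u = fps_diag (Abs_fps (\<lambda>i. fps_nth H i oo Y) * fps_const u)"
    by (simp add: fps_subst_def fps_diag_mult fps_diag_const)
  then show ?thesis by (simp add: fps_diag_nth)
qed

lemma has_field_derivative_fps_subst_nth:
  fixes \<phi> u :: "real fps"
  assumes "fps_nth \<phi> 0 = 0" "fps_nth u 0 = 0"
  shows "((\<lambda>\<tau>. fps_nth (fps_subst H (\<phi> + fps_const \<tau> * u)) k) has_field_derivative
    fps_nth (fps_subst (fps_dy H) (\<phi> + fps_const \<tau> * u) * u) k) (at \<tau>)"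
proof -
  have "fps_nth (\<phi> + fps_const \<tau> * u) 0 = 0" using assms by simp
  note * = fps_compose_deriv_mult_nth[OF this assms(2)]
  show ?thesis
    unfolding fps_subst_mult_nth fps_subst_nth fps_dy_def fps_nth_Abs_fps *
    by (intro DERIV_sum DERIV_cmult has_field_derivative_fps_power_nth)
qed

text \<open>Only finitely many powers of the substituted series enter a given coefficient.
  Polynomial dependence on \<tau> is what makes the leading coefficient accessible to
  algebra.\<close>

lemma real_polynomial_function_fps_subst_nth:
  "real_polynomial_function (\<lambda>\<tau>. fps_nth (fps_subst H (\<phi> + fps_const \<tau> * u)) k)"
proof -
  have id: "real_polynomial_function (\<lambda>\<tau>::real. \<tau>)"
    by (rule real_polynomial_function.intros(1)) (rule bounded_linear_ident)
  have "real_polynomial_function (\<lambda>\<tau>. fps_nth ((\<phi> + fps_const \<tau> * u) ^ j) m)" for j m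
  proof (induction j arbitrary: m)
    case 0
    then show ?case by (simp add: real_polynomial_function.intros(2))
  next
    case (Suc j)
    show ?case
      unfolding power_Suc fps_mult_nth[of "_ + _"] fps_add_nth fps_mult_left_const_nth
      by (intro real_polynomial_function_sum finite_atLeastAtMost real_polynomial_function.intros(2-4) id Suc)
  qed
  then show ?thesis
    unfolding fps_subst_nth
    by (intro real_polynomial_function_sum finite_atMost real_polynomial_function.intros(4)
          real_polynomial_function.intros(2))
qed

section \<open>The first integral equation\<close>

text \<open>If \<open>P\<close> is nonzero and vanishes to order \<open>m\<close> at
  \<open>r\<close>, cancelling that power of the linear factor and evaluating at \<open>r\<close>
  leaves \<open>of_nat m * poly R r = poly L r\<close>, which \<open>res\<close> excludes.\<close>

lemma first_order_poly_ode_imp_0: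
  fixes P R L :: "'a::field_char_0 poly"
  assumes eq: "[:- r, 1:] * R * pderiv P = L * P"
    and res: "\<And>m. of_nat m * poly R r \<noteq> poly L r"
  shows "P = 0"
proof (rule ccontr)
  assume "P \<noteq> 0"
  then obtain s where P: "P = [:- r, 1:] ^ order r P * s" and s: "\<not> [:- r, 1:] dvd s"
    using order_decomp by blast
  define m where "m = order r P"
  let ?X = "[:- r, 1:]"
  have "x * pderiv (x ^ m * s) = x ^ m * (x * pderiv s + of_nat m * s)" if "pderiv x = 1" for x
  proof (cases m)
    case (Suc k)
    have *: "smult (of_nat l) q = of_nat l * q" for l and q :: "'a poly"
      by (simp add: of_nat_poly)
    have "pderiv (x ^ m * s) = x ^ m * pderiv s + s * (of_nat m * x ^ k)"
      unfolding Suc pderiv_mult pderiv_power_Suc that * by (simp only: mult_1_right)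
    then show ?thesis
      by (simp only: Suc power_Suc distrib_left mult_ac)
  qed simp
  from this[of ?X] have "?X * pderiv P = ?X ^ m * (?X * pderiv s + of_nat m * s)"
    using P by (simp add: m_def pderiv_pCons)
  then have "?X ^ m * (R * (?X * pderiv s + of_nat m * s)) = ?X ^ m * (L * s)"
    using eq P by (metis m_def mult.assoc mult.left_commute)
  then have "R * (?X * pderiv s + of_nat m * s) = L * s"
    by simp
  then have "poly (R * (?X * pderiv s + of_nat m * s)) r = poly (L * s) r"
    by simp
  then have "(of_nat m * poly R r - poly L r) * poly s r = 0"
    by (simp add: algebra_simps)
  then show False
    using res[of m] s by (simp add: poly_eq_0_iff_dvd)
qed

lemma map_poly_of_real_mult:
  "map_poly complex_of_real (p * q) = map_poly of_real p * map_poly of_real q"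
  by (rule poly_eqI) (simp add: coeff_map_poly coeff_mult)

text \<open>At a nonreal root \<open>r\<close> of the quadratic, the order argument would equate the
  purely imaginary \<open>m * c * (r - cnj r)\<close> with \<open>d * r\<close>, whose real part
  \<open>d * b / (2 * c)\<close> is nonzero.\<close>

lemma real_poly_ode_imp_0:
  fixes p :: "real poly"
  assumes eq: "[:- a, - b, c:] * pderiv p = [:0, d:] * p"
    and "b \<noteq> 0" "c > 0" "d > 0" "b\<^sup>2 + 4 * a * c < 0"
  shows "p = 0"
proof -
  \<comment> \<open>Quadratic formula with negative discriminant: \<open>w\<close> is the imaginary
    part of the root in the upper half-plane.\<close>
  define w where "w = sqrt (- (b\<^sup>2 + 4 * a * c)) / (2 * c)"
  define r where "r = Complex (b / (2 * c)) w"
  have "w\<^sup>2 = - (b\<^sup>2 + 4 * a * c) / (2 * c)\<^sup>2"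
    using assms by (simp add: w_def power_divide)
  then have "(b / (2 * c))\<^sup>2 + w\<^sup>2 = (b\<^sup>2 + - (b\<^sup>2 + 4 * a * c)) / (2 * c)\<^sup>2"
    by (simp only: power_divide add_divide_distrib)
  then have w: "c * ((b / (2 * c))\<^sup>2 + w\<^sup>2) = - a"
    using \<open>c > 0\<close> by (simp add: power2_eq_square)
  have *: "map_poly complex_of_real [:- a, - b, c:] = [:- r, 1:] * ([:of_real c:] * [:- cnj r, 1:])"
    using w \<open>c > 0\<close>
    by (simp add: map_poly_pCons complex_eq_iff r_def algebra_simps power2_eq_square)
  have pd: "map_poly complex_of_real (pderiv p) = pderiv (map_poly of_real p)"
    by (rule poly_eqI) (simp add: coeff_map_poly coeff_pderiv)
  have "map_poly complex_of_real p = 0"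
  proof (rule first_order_poly_ode_imp_0)
    show "[:- r, 1:] * ([:of_real c:] * [:- cnj r, 1:]) * pderiv (map_poly complex_of_real p) = [:0, of_real d:] * map_poly of_real p"
      using arg_cong[OF eq, of "map_poly complex_of_real"]
      by (simp only: map_poly_of_real_mult * pd) (simp add: map_poly_pCons)
    show "of_nat m * poly ([:of_real c:] * [:- cnj r, 1:]) r \<noteq> poly [:0, complex_of_real d:] r" for m
      using assms by (auto simp: complex_eq_iff r_def)
  qed
  then show ?thesis
    by (simp add: map_poly_eq_0_iff)
qed

section \<open>Series determined by their restrictions to the curves\<close>

text \<open>The parameter derivative of a constant restriction is zero, which kills
  \<open>fps_dy H\<close> after cancelling \<open>u\<close>; the \<open>s\<close>-derivative then
  kills \<open>fps_dx H\<close>.\<close>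

lemma fps_subst_const_imp_subst_partials_0:
  fixes \<phi> u :: "real fps"
  assumes \<phi>: "fps_nth \<phi> 0 = 0" and u: "fps_nth u 0 = 0" "u \<noteq> 0"
    and const: "\<And>\<tau> k. k > 0 \<Longrightarrow> fps_nth (fps_subst H (\<phi> + fps_const \<tau> * u)) k = 0"
  shows "fps_subst (fps_dy H) (\<phi> + fps_const \<tau> * u) = 0"
    and "fps_subst (fps_dx H) (\<phi> + fps_const \<tau> * u) = 0"
proof -
  have Y: "fps_nth (\<phi> + fps_const \<tau> * u) 0 = 0"
    using \<phi> u by simp
  have "fps_nth (fps_subst (fps_dy H) (\<phi> + fps_const \<tau> * u) * u) k = 0" for k
  proof -
    have "fps_nth (fps_subst H (\<phi> + fps_const \<sigma> * u)) k = (if k = 0 then fps_nth (fps_nth H 0) 0 else 0)" for \<sigma>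
      using const by (simp add: fps_subst_nth_0)
    then have "((\<lambda>\<tau>. fps_nth (fps_subst H (\<phi> + fps_const \<tau> * u)) k) has_field_derivative 0) (at \<tau>)"
      by simp
    then show ?thesis
      using has_field_derivative_fps_subst_nth[OF \<phi> u(1)] DERIV_unique by blast
  qed
  then have "fps_subst (fps_dy H) (\<phi> + fps_const \<tau> * u) * u = 0"
    by (intro fps_ext) simp
  then show 1: "fps_subst (fps_dy H) (\<phi> + fps_const \<tau> * u) = 0"
    using u by simp
  have "fps_deriv (fps_subst H (\<phi> + fps_const \<tau> * u)) = 0"
    by (rule fps_ext) (simp add: const)
  then show "fps_subst (fps_dx H) (\<phi> + fps_const \<tau> * u) = 0"
    unfolding fps_deriv_subst[OF Y] 1 by simp
qed

lemma fps_dx_nth: "fps_nth (fps_nth (fps_dx H) i) j = real (Suc i) * fps_nth (fps_nth H (Suc i)) j"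
  by (simp only: fps_dx_def fps_deriv_nth Suc_eq_plus1[symmetric] fps_of_nat[symmetric] fps_mult_left_const_nth)

lemma fps_dy_nth: "fps_nth (fps_nth (fps_dy H) i) j = real (Suc j) * fps_nth (fps_nth H i) (Suc j)"
  by (simp add: fps_dy_def)

text \<open>Vanishing on the family passes to both partial derivatives, and every coefficient is, up
  to a nonzero factor, the constant term of an iterated partial derivative.\<close>

lemma fps_subst_family_0_imp_0:
  fixes \<phi> u :: "real fps"
  assumes \<phi>: "fps_nth \<phi> 0 = 0" and u: "fps_nth u 0 = 0" "u \<noteq> 0"
    and zero: "\<And>\<tau>. fps_subst H (\<phi> + fps_const \<tau> * u) = 0"
  shows "H = 0"
proof -
  \<comment> \<open>First only \<open>y\<close>-derivatives, for the coefficients without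
    \<open>x\<close>; the series is generalized because the induction replaces it by its
    derivative.\<close>
  have "fps_nth (fps_nth H 0) j = 0" if "\<And>\<tau>. fps_subst H (\<phi> + fps_const \<tau> * u) = 0" for H j
    using that
  proof (induction j arbitrary: H)
    case 0
    then show ?case by (metis fps_subst_nth_0 fps_zero_nth)
  next
    case (Suc j)
    have "fps_nth (fps_nth (fps_dy H) 0) j = 0"
      by (rule Suc.IH, rule fps_subst_const_imp_subst_partials_0[OF \<phi> u]) (simp add: Suc.prems)
    then show ?case by (simp add: fps_dy_nth)
  qed note base = this
  have "fps_nth (fps_nth H i) j = 0" for i j
    using zero
  proof (induction i arbitrary: H)
    case 0
    then show ?case by (rule base)
  next
    case (Suc i)
    have "fps_nth (fps_nth (fps_dx H) i) j = 0"
      by (rule Suc.IH, rule fps_subst_const_imp_subst_partials_0[OF \<phi> u]) (simp add: Suc.prems)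
    then show ?case unfolding fps_dx_nth by simp
  qed
  then show ?thesis by (intro fps_ext) simp
qed

lemma fps_dx_dy_eq_0_imp_const:
  assumes "fps_dx H = 0" "fps_dy H = 0"
  shows "H = fps_const (fps_const (fps_nth (fps_nth H 0) 0))"
proof (intro fps_ext)
  fix i j
  show "fps_nth (fps_nth H i) j = fps_nth (fps_nth (fps_const (fps_const (fps_nth (fps_nth H 0) 0))) i) j"
    using fps_dx_nth[of H "i - 1" j] fps_dy_nth[of H i "j - 1"] assms
    by (cases i; cases j) auto
qed

text \<open>The second \<open>\<tau>\<close>-derivative of the left-hand side series is divisible by \<open>s\<^bsup>2n\<^esup>\<close>.\<close>

lemma fps_subst_affine_nth:
  fixes \<phi> :: "real fps"
  assumes \<phi>: "fps_nth \<phi> 0 = 0" and n: "n \<ge> 1" and k: "k < 2 * n"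
  shows "fps_nth (fps_subst G (\<phi> + fps_const \<tau> * fps_X ^ n)) k =
    fps_nth (fps_subst G \<phi>) k + \<tau> * fps_nth (fps_X ^ n * fps_subst (fps_dy G) \<phi>) k"
proof -
  let ?Y = "\<lambda>\<tau>. \<phi> + fps_const \<tau> * fps_X ^ n"
  let ?D = "\<lambda>\<tau>. fps_nth (fps_subst (fps_dy G) (?Y \<tau>) * fps_X ^ n) k"
  have u: "fps_nth (fps_X ^ n :: real fps) 0 = 0" using n by simp
  note der = has_field_derivative_fps_subst_nth[OF \<phi> u]
  \<comment> \<open>Below index \<open>n\<close> the factor \<open>fps_X ^ n\<close> makes
    \<open>?D\<close> zero; from \<open>n\<close> on, its derivative is the coefficient of index
    \<open>k - n < n\<close> of a multiple of \<open>fps_X ^ n\<close>.\<close>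
  have "(?D has_field_derivative 0) (at \<sigma>)" for \<sigma>
  proof (cases "k < n")
    case False
    then have "?D = (\<lambda>\<tau>. fps_nth (fps_subst (fps_dy G) (?Y \<tau>)) (k - n))"
      by (simp add: fps_X_power_mult_right_nth)
    moreover have "fps_nth (fps_subst (fps_dy (fps_dy G)) (?Y \<sigma>) * fps_X ^ n) (k - n) = 0"
      using k by (simp add: fps_X_power_mult_right_nth)
    ultimately show ?thesis using der[of "fps_dy G" "k - n" \<sigma>] by simp
  qed (simp add: fps_X_power_mult_right_nth)
  then have D: "?D \<sigma> = ?D 0" for \<sigma>
    using DERIV_isconst_all[of ?D] by blast
  have "((\<lambda>\<tau>. fps_nth (fps_subst G (?Y \<tau>)) k - \<tau> * ?D 0) has_field_derivative 0) (at \<sigma>)" for \<sigma>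
    using der[of G k \<sigma>] by (auto intro!: derivative_eq_intros simp: D[of \<sigma>])
  then have "fps_nth (fps_subst G (?Y \<tau>)) k - \<tau> * ?D 0 = fps_nth (fps_subst G (?Y 0)) k - 0 * ?D 0"
    using DERIV_isconst_all[of "\<lambda>\<tau>. fps_nth (fps_subst G (?Y \<tau>)) k - \<tau> * ?D 0"] by blast
  then show ?thesis by (simp add: mult.commute)
qed

lemma fps_eq_X_power_mult_shift:
  assumes "\<And>k. k < n \<Longrightarrow> fps_nth f k = 0"
  shows "f = fps_X ^ n * fps_shift n f"
  by (rule fps_ext) (simp add: assms fps_X_power_mult_nth)

lemma fps_mult_nth_leading:
  fixes f g :: "'a::comm_ring_1 fps"
  assumes "\<And>k. k < d \<Longrightarrow> fps_nth g k = 0"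
  shows "fps_nth (f * g) d = fps_nth f 0 * fps_nth g d"
proof -
  have "(\<Sum>i=0..d. fps_nth f i * fps_nth g (d - i)) = (\<Sum>i=0..d. if i = 0 then fps_nth f 0 * fps_nth g d else 0)"
    by (rule sum.cong) (auto simp: assms)
  then show ?thesis by (simp add: fps_mult_nth)
qed

text \<open>The formal core: the system enters only through its Taylor series, and Andreev's data
  through the first coefficients along \<open>\<phi>\<close>.\<close>

lemma formal_first_integral_imp_const:
  fixes P Q H :: "real fps fps" and \<phi> :: "real fps"
  assumes \<phi>: "fps_nth \<phi> 0 = 0" "\<phi> + fps_subst P \<phi> = 0"
    and P01: "fps_nth (fps_nth P 0) 1 = 0"
    and n: "n \<ge> 1"
    and f: "\<And>k. k < 2 * n - 1 \<Longrightarrow> fps_nth (fps_subst Q \<phi>) k = 0" "fps_nth (fps_subst Q \<phi>) (2 * n - 1) = a"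
    and div: "\<And>k. k < n - 1 \<Longrightarrow> fps_nth (fps_subst (fps_dx P + fps_dy Q) \<phi>) k = 0"
      "fps_nth (fps_subst (fps_dx P + fps_dy Q) \<phi>) (n - 1) = b"
    and ab: "b \<noteq> 0" "b\<^sup>2 + 4 * a * real n < 0"
    and H: "(fps_y + P) * fps_dx H + Q * fps_dy H = 0"
  shows "H = fps_const (fps_const (fps_nth (fps_nth H 0) 0))"
proof (rule ccontr)
  assume nconst: "\<not> ?thesis"
  let ?u = "fps_X ^ n :: real fps"
  define Y where "Y = (\<lambda>\<tau>. \<phi> + fps_const \<tau> * ?u)"
  define g where "g = (\<lambda>\<tau>. fps_subst H (Y \<tau>))"
  define D where "D = (\<lambda>\<tau>. fps_subst (fps_dy H) (Y \<tau>) * ?u)"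
  have u: "fps_nth ?u 0 = 0" "?u \<noteq> 0" using n by simp_all
  have Y0: "fps_nth (Y \<tau>) 0 = 0" for \<tau> using u \<phi> by (simp add: Y_def)
  have der_g: "((\<lambda>\<tau>. fps_nth (g \<tau>) k) has_field_derivative fps_nth (D \<tau>) k) (at \<tau>)" for k \<tau>
    unfolding g_def Y_def D_def by (rule has_field_derivative_fps_subst_nth[OF \<phi>(1) u(1)])

  \<comment> \<open>\<open>W\<close> is the \<open>y\<close>-derivative of \<open>y + P\<close> on
    the branch, \<open>A\<close> the first component of the field on the curve, and \<open>C\<close>
    the rate of change of \<open>y - \<phi>(x)\<close> there.\<close>
  define W where "W = 1 + fps_subst (fps_dy P) \<phi>"
  define A where "A = (\<lambda>\<tau>. Y \<tau> + fps_subst P (Y \<tau>))"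
  define C where "C = (\<lambda>\<tau>. fps_subst Q (Y \<tau>) - A \<tau> * fps_deriv \<phi>)"
  have A: "fps_nth (A \<tau>) k = \<tau> * fps_nth (?u * W) k" if "k < 2 * n" for k \<tau>
  proof -
    have "fps_nth \<phi> k + fps_nth (fps_subst P \<phi>) k = 0"
      using \<phi>(2) by (metis fps_add_nth fps_zero_nth)
    then show ?thesis
      by (simp add: A_def Y_def W_def fps_subst_affine_nth[OF \<phi>(1) n that] algebra_simps)
  qed
  have "fps_deriv (\<phi> + fps_subst P \<phi>) = 0" using \<phi>(2) by simp
  \<comment> \<open>Implicit differentiation of the branch equation. Through it, subtracting
    \<open>A \<tau> * fps_deriv \<phi>\<close> completes \<open>fps_dy Q\<close> to the divergence
    in \<open>C\<close>.\<close>
  then have W: "W * fps_deriv \<phi> = - fps_subst (fps_dx P) \<phi>"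
    by (simp add: fps_deriv_subst[OF \<phi>(1)] W_def algebra_simps eq_neg_iff_add_eq_0)
  have C: "fps_nth (C \<tau>) k = fps_nth (fps_subst Q \<phi>) k + \<tau> * fps_nth (?u * fps_subst (fps_dx P + fps_dy Q) \<phi>) k"
    if "k < 2 * n" for k \<tau>
  proof -
    have "fps_nth (A \<tau> * fps_deriv \<phi>) k = \<tau> * fps_nth (?u * (W * fps_deriv \<phi>)) k"
    proof -
      \<comment> \<open>The coefficient of index \<open>k < 2 * n\<close> of the product only sees
        coefficients of \<open>A \<tau>\<close> in the range where \<open>A\<close> is linear in
        \<tau>.\<close>
      have "fps_nth (A \<tau> * fps_deriv \<phi>) k = fps_nth (fps_const \<tau> * (?u * W) * fps_deriv \<phi>) k"
        unfolding fps_mult_nth[of _ "fps_deriv \<phi>"] using that by (intro sum.cong) (auto simp: A)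
      then show ?thesis by (simp add: mult.assoc)
    qed
    then show ?thesis
      by (simp add: C_def Y_def fps_subst_affine_nth[OF \<phi>(1) n that] W fps_subst_add algebra_simps)
  qed
  \<comment> \<open>The exponent \<open>2 * n - 1\<close> is both the order of \<open>Q\<close> on
    the branch and the sum of \<open>n\<close> and the order \<open>n - 1\<close> of the divergence,
    so both terms of \<open>C\<close> contribute to the constant term of \<open>C1\<close>.\<close>
  define A1 where "A1 = (\<lambda>\<tau>. fps_shift n (A \<tau>))"
  define C1 where "C1 = (\<lambda>\<tau>. fps_shift (2 * n - 1) (C \<tau>))"
  have AA1: "A \<tau> = ?u * A1 \<tau>" for \<tau>
    unfolding A1_def using n by (intro fps_eq_X_power_mult_shift) (simp add: A fps_X_power_mult_nth)
  have CC1: "C \<tau> = fps_X ^ (2 * n - 1) * C1 \<tau>" for \<tau>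
    unfolding C1_def using n f div by (intro fps_eq_X_power_mult_shift) (auto simp: C fps_X_power_mult_nth)
  have A10: "fps_nth (A1 \<tau>) 0 = \<tau>" for \<tau>
    using n P01 by (simp add: A1_def A fps_X_power_mult_nth W_def fps_subst_nth_0 fps_dy_nth)
  have C10: "fps_nth (C1 \<tau>) 0 = a + b * \<tau>" for \<tau>
  proof -
    have "2 * n - 1 - n = n - 1" by simp
    then show ?thesis using n f div by (simp add: C1_def C fps_X_power_mult_nth)
  qed

  \<comment> \<open>The equation for \<open>H\<close> in the coordinates \<open>s\<close> and
    \<tau>, multiplied by \<open>s\<close> and divided by \<open>s\<close> to the power
    \<open>n\<close>; \<open>D\<close> stands for the \<tau>-derivative of \<open>g\<close>.\<close>
  have main: "A1 \<tau> * (fps_X * fps_deriv (g \<tau>)) + (C1 \<tau> - of_nat n * fps_const \<tau> * A1 \<tau>) * D \<tau> = 0" for \<tau>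
  proof -
    let ?x = "fps_subst (fps_dx H) (Y \<tau>)" and ?y = "fps_subst (fps_dy H) (Y \<tau>)"
    have "fps_subst ((fps_y + P) * fps_dx H + Q * fps_dy H) (Y \<tau>) = 0"
      by (simp add: H)
    then have 1: "A \<tau> * ?x + fps_subst Q (Y \<tau>) * ?y = 0"
      by (simp add: fps_subst_add fps_subst_mult[OF Y0] fps_subst_y[OF Y0] A_def)
    have xu: "fps_X * fps_deriv ?u = of_nat n * ?u"
      unfolding fps_deriv_power using n by (cases n) (simp_all only: fps_of_nat, simp_all add: mult_ac del: of_nat_Suc)
    have xx: "fps_X * fps_X ^ (2 * n - 1) = ?u * ?u"
      using n by (simp flip: power_Suc power_add add: mult_2)
    have "fps_X * fps_deriv (g \<tau>) = fps_X * ?x + ?y * (fps_X * fps_deriv \<phi> + fps_const \<tau> * (fps_X * fps_deriv ?u))"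
      by (simp add: g_def fps_deriv_subst[OF Y0], simp add: Y_def algebra_simps)
    then have 2: "fps_X * ?x = fps_X * fps_deriv (g \<tau>) - ?y * (fps_X * fps_deriv \<phi> + fps_const \<tau> * (of_nat n * ?u))"
      by (simp add: xu)
    have 3: "fps_X * fps_subst Q (Y \<tau>) = ?u * ?u * C1 \<tau> + fps_X * A \<tau> * fps_deriv \<phi>"
    proof -
      have "fps_subst Q (Y \<tau>) = C \<tau> + A \<tau> * fps_deriv \<phi>" by (simp add: C_def)
      then show ?thesis unfolding CC1 xx[symmetric] by (simp only: distrib_left mult.assoc)
    qed
    have "A \<tau> * (fps_X * ?x) + fps_X * fps_subst Q (Y \<tau>) * ?y = 0"
      using arg_cong[OF 1, of "\<lambda>z. fps_X * z"] by (simp add: algebra_simps)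
    then have "?u * (A1 \<tau> * (fps_X * fps_deriv (g \<tau>)) + (C1 \<tau> - of_nat n * fps_const \<tau> * A1 \<tau>) * D \<tau>) = 0"
      unfolding 2 3 D_def AA1 by (simp add: algebra_simps)
    then show ?thesis using u(2) by simp
  qed

  \<comment> \<open>Otherwise \<open>H\<close> is constant on every curve of the family, so both
    partial derivatives vanish on the family and hence identically.\<close>
  have "\<exists>k>0. \<exists>\<tau>. fps_nth (g \<tau>) k \<noteq> 0"
  proof (rule ccontr)
    assume "\<not> ?thesis"
    then have *: "fps_nth (fps_subst H (\<phi> + fps_const \<tau> * ?u)) k = 0" if "k > 0" for k \<tau>
      using that unfolding g_def Y_def by blast
    have "fps_dx H = 0"
      by (rule fps_subst_family_0_imp_0[OF \<phi>(1) u], rule fps_subst_const_imp_subst_partials_0[OF \<phi>(1) u]) (rule *)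
    moreover have "fps_dy H = 0"
      by (rule fps_subst_family_0_imp_0[OF \<phi>(1) u], rule fps_subst_const_imp_subst_partials_0[OF \<phi>(1) u]) (rule *)
    ultimately show False
      using nconst fps_dx_dy_eq_0_imp_const by blast
  qed
  then obtain d where d: "d > 0" "\<exists>\<tau>. fps_nth (g \<tau>) d \<noteq> 0"
    and min: "\<And>k \<tau>. k < d \<Longrightarrow> k > 0 \<Longrightarrow> fps_nth (g \<tau>) k = 0"
    using exists_least_iff[of "\<lambda>k. k > 0 \<and> (\<exists>\<tau>. fps_nth (g \<tau>) k \<noteq> 0)"] by metis
  have D_less: "fps_nth (D \<tau>) k = 0" if "k < d" for k \<tau>
  proof -
    have "fps_nth (g \<sigma>) k = (if k = 0 then fps_nth (fps_nth H 0) 0 else 0)" for \<sigma>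
      using min[OF that] by (simp add: g_def fps_subst_nth_0)
    then have "((\<lambda>\<tau>. fps_nth (g \<tau>) k) has_field_derivative 0) (at \<tau>)" by simp
    then show ?thesis using der_g DERIV_unique by blast
  qed
  obtain p where p: "fps_nth (g \<tau>) d = poly p \<tau>" for \<tau>
  proof -
    have "real_polynomial_function (\<lambda>\<tau>. fps_nth (g \<tau>) d)"
      unfolding g_def Y_def by (rule real_polynomial_function_fps_subst_nth)
    then obtain c N where "(\<lambda>\<tau>. fps_nth (g \<tau>) d) = (\<lambda>x. \<Sum>i\<le>N::nat. c i * x ^ i)"
      unfolding real_polynomial_function_iff_sum by blast
    then have "fps_nth (g \<tau>) d = poly (\<Sum>i\<le>N. monom (c i) i) \<tau>" for \<tau>
      by (simp add: poly_sum poly_monom fun_eq_iff)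
    then show ?thesis by (rule that)
  qed
  have Dd: "fps_nth (D \<tau>) d = poly (pderiv p) \<tau>" for \<tau>
    using der_g[of d \<tau>] poly_DERIV[of p \<tau>] DERIV_unique unfolding p by blast
  \<comment> \<open>Coefficient of index \<open>d\<close> in \<open>main\<close>:
    \<open>fps_X * fps_deriv (g \<tau>)\<close> and \<open>D \<tau>\<close> have no lower terms, so
    only the constant terms of their cofactors enter.\<close>
  have "poly ([:- a, - b, real n:] * pderiv p) \<tau> = poly ([:0, real d:] * p) \<tau>" for \<tau>
  proof -
    have Xg: "fps_nth (fps_X * fps_deriv (g \<tau>)) k = real k * fps_nth (g \<tau>) k" for k
      by (cases k) simp_all
    have "fps_nth (A1 \<tau> * (fps_X * fps_deriv (g \<tau>))) d = \<tau> * (real d * poly p \<tau>)"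
    proof (subst fps_mult_nth_leading)
      show "fps_nth (fps_X * fps_deriv (g \<tau>)) k = 0" if "k < d" for k
        using min[OF that] unfolding Xg by (cases "k = 0") auto
    qed (simp only: A10 p Xg)
    moreover have "fps_nth ((C1 \<tau> - of_nat n * fps_const \<tau> * A1 \<tau>) * D \<tau>) d
        = (a + b * \<tau> - real n * \<tau> * \<tau>) * poly (pderiv p) \<tau>"
      by (subst fps_mult_nth_leading) (auto simp: D_less A10 C10 Dd)
    ultimately have "\<tau> * (real d * poly p \<tau>) + (a + b * \<tau> - real n * \<tau> * \<tau>) * poly (pderiv p) \<tau> = 0"
      using main[of \<tau>] by (metis fps_add_nth fps_zero_nth)
    then show ?thesis by (simp add: algebra_simps)
  qed
  then have "[:- a, - b, real n:] * pderiv p = [:0, real d:] * p"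
    by (intro poly_eq_poly_eq_iff[THEN iffD1]) auto
  then have "p = 0"
    using ab n d(1) by (intro real_poly_ode_imp_0) auto
  then show False using d p by simp
qed

section \<open>Taylor expansion of smooth functions\<close>

lemma has_field_derivative_pd:
  assumes "open U" "(x, y) \<in> U" "G differentiable_on U"
  shows "((\<lambda>t. G (t, y)) has_field_derivative pd_x G (x, y)) (at x)"
    and "((\<lambda>t. G (x, t)) has_field_derivative pd_y G (x, y)) (at y)"
proof -
  have G: "G differentiable (at (x, y))"
    using assms by (metis at_within_open differentiable_on_def)
  have "(\<lambda>t. (t, y)) differentiable (at x)" "(\<lambda>t. (x, t)) differentiable (at y)"
    by (auto intro!: derivative_eq_intros simp: differentiable_def)
  then have "(\<lambda>t. G (t, y)) differentiable (at x)" "(\<lambda>t. G (x, t)) differentiable (at y)"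
    using G differentiable_chain_at[of "\<lambda>t. (t, y)" x G] differentiable_chain_at[of "\<lambda>t. (x, t)" y G]
    by (simp_all add: o_def)
  then show "((\<lambda>t. G (t, y)) has_field_derivative pd_x G (x, y)) (at x)"
    "((\<lambda>t. G (x, t)) has_field_derivative pd_y G (x, y)) (at y)"
    by (simp_all add: pd_x_def pd_y_def DERIV_deriv_iff_real_differentiable)
qed

text \<open>Mean value theorem twice: for the increment in \<open>y\<close> as a function of
  \<open>x\<close>, then for \<open>g' \<xi>\<close> as a function of \<open>y\<close>.\<close>

lemma second_difference_mvt:
  fixes g :: "real \<Rightarrow> real \<Rightarrow> real"
  assumes "h > 0"
    and 1: "\<And>x y. x \<in> {a..a + h} \<Longrightarrow> y \<in> {b..b + h} \<Longrightarrow> ((\<lambda>t. g t y) has_field_derivative g' x y) (at x)"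
    and 2: "\<And>x y. x \<in> {a..a + h} \<Longrightarrow> y \<in> {b..b + h} \<Longrightarrow> ((\<lambda>t. g' x t) has_field_derivative g'' x y) (at y)"
  obtains \<xi> \<eta> where "\<xi> \<in> {a..a + h}" "\<eta> \<in> {b..b + h}"
    "g (a + h) (b + h) - g (a + h) b - g a (b + h) + g a b = h * h * g'' \<xi> \<eta>"
proof -
  have "\<exists>\<xi>. \<xi> > a \<and> \<xi> < a + h \<and> (g (a + h) (b + h) - g (a + h) b) - (g a (b + h) - g a b)
     = (a + h - a) * (g' \<xi> (b + h) - g' \<xi> b)"
    using \<open>h > 0\<close> by (intro MVT2) (auto intro!: derivative_eq_intros 1)
  then obtain \<xi> where \<xi>: "\<xi> > a" "\<xi> < a + h" "(g (a + h) (b + h) - g (a + h) b) - (g a (b + h) - g a b)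
     = h * (g' \<xi> (b + h) - g' \<xi> b)" by auto
  have "\<exists>\<eta>. \<eta> > b \<and> \<eta> < b + h \<and> g' \<xi> (b + h) - g' \<xi> b = (b + h - b) * g'' \<xi> \<eta>"
    using \<open>h > 0\<close> \<xi> by (intro MVT2) (auto intro!: 2)
  then obtain \<eta> where "\<eta> > b" "\<eta> < b + h" "g' \<xi> (b + h) - g' \<xi> b = h * g'' \<xi> \<eta>" by auto
  then show thesis using \<xi> by (intro that[of \<xi> \<eta>]) auto
qed

text \<open>Schwarz's theorem: one second difference over a small square equals its area times
  either mixed derivative at some point, and both mixed derivatives are continuous.\<close>

lemma pd_x_pd_y_commute:
  assumes U: "open U" "(a, b) \<in> U" and G: "Ck_on 2 G U"
  shows "pd_x (pd_y G) (a, b) = pd_y (pd_x G) (a, b)"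
proof -
  let ?f = "pd_y (pd_x G)" and ?g = "pd_x (pd_y G)"
  have dG: "G differentiable_on U" "pd_x G differentiable_on U" "pd_y G differentiable_on U"
    and cont: "continuous_on U ?f" "continuous_on U ?g"
    using G by (simp_all add: numeral_2_eq_2)
  obtain r where r: "r > 0" "ball (a, b) r \<subseteq> U"
    using U open_contains_ball by blast
  have "\<bar>?g (a, b) - ?f (a, b)\<bar> \<le> e" if "e > 0" for e
  proof -
    have "isCont ?f (a, b)" "isCont ?g (a, b)"
      using cont U by (simp_all add: continuous_on_eq_continuous_at)
    moreover have "e / 2 > 0" using that by simp
    ultimately obtain d1 d2 where d: "d1 > 0" "\<And>z. dist z (a, b) < d1 \<Longrightarrow> dist (?f z) (?f (a, b)) < e / 2"
      "d2 > 0" "\<And>z. dist z (a, b) < d2 \<Longrightarrow> dist (?g z) (?g (a, b)) < e / 2"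
      unfolding continuous_at_eps_delta by blast
    \<comment> \<open>Points of the square lie within \<open>2 * h\<close> of the corner, hence a
      third of the smallest radius suffices.\<close>
    define h where "h = min r (min d1 d2) / 3"
    have h: "h > 0" "2 * h < r" "2 * h < d1" "2 * h < d2"
      using r(1) d(1,3) by (auto simp: h_def)
    have near: "dist (x, y) (a, b) \<le> 2 * h" if "x \<in> {a..a + h}" "y \<in> {b..b + h}" for x y
      using norm_Pair_le[of "x - a" "y - b"] that by (auto simp: dist_norm)
    then have in_U: "(x, y) \<in> U" if "x \<in> {a..a + h}" "y \<in> {b..b + h}" for x y
      using r(2) h(2) that by (fastforce simp: dist_commute)
    note D = has_field_derivative_pd[OF U(1) in_U]
    obtain x1 y1 where 1: "x1 \<in> {a..a + h}" "y1 \<in> {b..b + h}"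
      "G (a + h, b + h) - G (a + h, b) - G (a, b + h) + G (a, b) = h * h * ?f (x1, y1)"
      by (rule second_difference_mvt[OF h(1) D(1)[OF _ _ dG(1)] D(2)[OF _ _ dG(2)]])
    \<comment> \<open>The same lemma with the two variables interchanged.\<close>
    obtain y2 x2 where 2: "x2 \<in> {a..a + h}" "y2 \<in> {b..b + h}"
      "G (a + h, b + h) - G (a, b + h) - G (a + h, b) + G (a, b) = h * h * ?g (x2, y2)"
      by (rule second_difference_mvt[OF h(1) D(2)[OF _ _ dG(1)] D(1)[OF _ _ dG(3)]])
    have "h * h * ?f (x1, y1) = h * h * ?g (x2, y2)"
      using 1(3) 2(3) by linarith
    then have "?f (x1, y1) = ?g (x2, y2)"
      using h(1) by simp
    moreover have "\<bar>?f (x1, y1) - ?f (a, b)\<bar> < e / 2" "\<bar>?g (x2, y2) - ?g (a, b)\<bar> < e / 2"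
      using d(2)[of "(x1, y1)"] d(4)[of "(x2, y2)"] near[OF 1(1,2)] near[OF 2(1,2)] h
      by (simp_all add: dist_real_def)
    ultimately show ?thesis by linarith
  qed
  then have "\<bar>?g (a, b) - ?f (a, b)\<bar> \<le> 0"
    by (rule field_le_epsilon) simp
  then show ?thesis by simp
qed

text \<open>Partial derivatives are local. This is needed since commutation is known only on
  \<open>U\<close> and must be applied under further derivatives.\<close>

lemma pd_cong:
  assumes "open U" "\<And>z. z \<in> U \<Longrightarrow> f z = g z" "z \<in> U"
  shows "pd_x f z = pd_x g z" "pd_y f z = pd_y g z"
proof -
  obtain x y where z: "z = (x, y)" by (cases z)
  have ev: "\<forall>\<^sub>F w in nhds (x, y). f w = g w"
    using assms unfolding z by (auto simp: eventually_nhds)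
  have "((\<lambda>t. (t, y)) \<longlongrightarrow> (x, y)) (nhds x)" "((\<lambda>t. (x, t)) \<longlongrightarrow> (x, y)) (nhds y)"
    by (auto intro!: tendsto_eq_intros filterlim_ident)
  from this[unfolded filterlim_iff, rule_format, OF ev]
  show "pd_x f z = pd_x g z" "pd_y f z = pd_y g z"
    by (auto simp: z pd_x_def pd_y_def intro!: deriv_cong_ev)
qed

lemma smooth_pd_y_funpow: "\<forall>k. Ck_on k G U \<Longrightarrow> \<forall>k. Ck_on k ((pd_y ^^ j) G) U"
  by (induction j) (simp, metis Ck_on.simps(2) comp_apply funpow.simps(2))

lemma pd_y_funpow_pd_x:
  assumes U: "open U" and G: "\<forall>k. Ck_on k G U"
  shows "z \<in> U \<Longrightarrow> (pd_y ^^ j) (pd_x G) z = pd_x ((pd_y ^^ j) G) z"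
proof (induction j arbitrary: z)
  case (Suc j)
  have "(pd_y ^^ Suc j) (pd_x G) z = pd_y (pd_x ((pd_y ^^ j) G)) z"
    using pd_cong(2)[OF U Suc.IH Suc.prems] by simp
  also have "\<dots> = pd_x (pd_y ((pd_y ^^ j) G)) z"
    using pd_x_pd_y_commute[of U "fst z" "snd z" "(pd_y ^^ j) G"] U Suc.prems smooth_pd_y_funpow[OF G]
    by simp
  finally show ?case by simp
qed simp

lemma pd_x_funpow_cong:
  assumes "open U" "\<And>z. z \<in> U \<Longrightarrow> f z = g z"
  shows "z \<in> U \<Longrightarrow> (pd_x ^^ i) f z = (pd_x ^^ i) g z"
proof (induction i arbitrary: z)
  case (Suc i)
  then show ?case using pd_cong(1)[OF assms(1) Suc.IH Suc.prems] by simp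
qed (simp add: assms)

lemma taylor_series_nth:
  "fps_nth (fps_nth (taylor_series G) i) j = (pd_x ^^ i) ((pd_y ^^ j) G) (0, 0) / (fact i * fact j)"
  by (simp add: taylor_series_def)

text \<open>\<open>taylor_series\<close> takes the \<open>y\<close>-derivatives first, so an inner
  \<open>pd_x\<close> has to be moved past them; this is where smoothness enters.\<close>

lemma taylor_series_pd_x:
  assumes "smooth_near_origin G"
  shows "taylor_series (pd_x G) = fps_dx (taylor_series G)"
proof (intro fps_ext)
  fix i j
  obtain U where U: "open U" "(0, 0) \<in> U" "\<forall>k. Ck_on k G U"
    using assms by (auto simp: smooth_near_origin_def)
  have "(pd_x ^^ i) ((pd_y ^^ j) (pd_x G)) (0, 0) = (pd_x ^^ i) (pd_x ((pd_y ^^ j) G)) (0, 0)"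
    using U by (intro pd_x_funpow_cong[OF U(1)] pd_y_funpow_pd_x) auto
  then show "fps_nth (fps_nth (taylor_series (pd_x G)) i) j = fps_nth (fps_nth (fps_dx (taylor_series G)) i) j"
    by (simp add: taylor_series_nth fps_dx_nth funpow_swap1 field_simps del: of_nat_Suc)
qed

lemma taylor_series_pd_y: "taylor_series (pd_y G) = fps_dy (taylor_series G)"
  by (intro fps_ext) (simp add: taylor_series_nth fps_dy_nth funpow_swap1 field_simps del: of_nat_Suc)

lemma smooth_near_origin_pd:
  assumes "smooth_near_origin G"
  shows "smooth_near_origin (pd_x G)" "smooth_near_origin (pd_y G)"
  using assms unfolding smooth_near_origin_def by (metis Ck_on.simps(2))+

section \<open>Taylor's theorem with remainder in two variables\<close>

text \<open>Truncation is by total degree, so that differentiating in either variable lowers the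
  bound by exactly one.\<close>

definition fps_trunc_eval :: "nat \<Rightarrow> real fps fps \<Rightarrow> real \<Rightarrow> real \<Rightarrow> real" where
  "fps_trunc_eval N H x y = (\<Sum>i<N. \<Sum>j<N-i. fps_nth (fps_nth H i) j * x ^ i * y ^ j)"

lemma has_field_derivative_fps_trunc_eval:
  "((\<lambda>t. fps_trunc_eval (Suc N) H t y) has_field_derivative fps_trunc_eval N (fps_dx H) x y) (at x)"
  "((\<lambda>t. fps_trunc_eval (Suc N) H x t) has_field_derivative fps_trunc_eval N (fps_dy H) x y) (at y)"
proof -
  have "fps_trunc_eval N (fps_dx H) x y
      = (\<Sum>i<Suc N. \<Sum>j<Suc N-i. fps_nth (fps_nth H i) j * (real i * x ^ (i - 1)) * y ^ j)"
    by (subst sum.lessThan_Suc_shift) (simp add: fps_trunc_eval_def fps_dx_nth mult_ac)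
  then show "((\<lambda>t. fps_trunc_eval (Suc N) H t y) has_field_derivative fps_trunc_eval N (fps_dx H) x y) (at x)"
    by (auto simp only: fps_trunc_eval_def intro!: derivative_eq_intros sum.cong) simp
  have "fps_trunc_eval N (fps_dy H) x y
      = (\<Sum>i<Suc N. \<Sum>j<N-i. fps_nth (fps_nth H i) (Suc j) * x ^ i * (real (Suc j) * y ^ j))"
    by (simp add: fps_trunc_eval_def fps_dy_nth mult_ac)
  also have "\<dots> = (\<Sum>i<Suc N. \<Sum>j<Suc (N-i). fps_nth (fps_nth H i) j * x ^ i * (real j * y ^ (j - 1)))"
    by (rule sum.cong[OF refl], subst sum.lessThan_Suc_shift) simp
  also have "\<dots> = (\<Sum>i<Suc N. \<Sum>j<Suc N-i. fps_nth (fps_nth H i) j * x ^ i * (real j * y ^ (j - 1)))"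
    by (rule sum.cong) (auto simp: Suc_diff_le)
  finally show "((\<lambda>t. fps_trunc_eval (Suc N) H x t) has_field_derivative fps_trunc_eval N (fps_dy H) x y) (at y)"
    by (auto simp only: fps_trunc_eval_def intro!: derivative_eq_intros sum.cong) simp
qed

lemma abs_diff_le_of_deriv_bound:
  fixes f :: "real \<Rightarrow> real"
  assumes "\<And>t. \<bar>t\<bar> \<le> \<bar>x\<bar> \<Longrightarrow> (f has_field_derivative f' t) (at t)"
    and "\<And>t. \<bar>t\<bar> \<le> \<bar>x\<bar> \<Longrightarrow> \<bar>f' t\<bar> \<le> B"
  shows "\<bar>f x - f 0\<bar> \<le> B * \<bar>x\<bar>"
proof -
  have "norm (f x - f 0) \<le> B * norm (x - 0)"
    by (rule field_differentiable_bound[of "{- \<bar>x\<bar>..\<bar>x\<bar>}" f f'])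
      (auto intro!: has_field_derivative_at_within assms)
  then show ?thesis by simp
qed

text \<open>The partial derivatives of a remainder are remainders of the partial derivatives, one
  order lower. Their bounds are integrated by the mean value inequality from the origin to
  \<open>(0, y)\<close> and on to \<open>(x, y)\<close>.\<close>

lemma taylor_remainder_bound:
  assumes "smooth_near_origin G"
  shows "\<exists>C\<ge>0. \<exists>\<delta>>0. \<forall>x y. \<bar>x\<bar> < \<delta> \<longrightarrow> \<bar>y\<bar> < \<delta> \<longrightarrow>
    \<bar>G (x, y) - fps_trunc_eval N (taylor_series G) x y\<bar> \<le> C * (\<bar>x\<bar> + \<bar>y\<bar>) ^ N"
  using assms
proof (induction N arbitrary: G)
  case 0
  then obtain U where U: "open U" "(0, 0) \<in> U" "\<forall>k. Ck_on k G U"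
    by (auto simp: smooth_near_origin_def)
  then have "isCont G (0, 0)"
    using Ck_on.simps(1) continuous_on_eq_continuous_at by blast
  then obtain d where d: "d > 0" "\<And>z. dist z (0, 0) < d \<Longrightarrow> dist (G z) (G (0, 0)) < 1"
    unfolding continuous_at_eps_delta by (meson zero_less_one)
  have "\<bar>G (x, y)\<bar> \<le> \<bar>G (0, 0)\<bar> + 1" if "\<bar>x\<bar> < d / 2" "\<bar>y\<bar> < d / 2" for x y
  proof -
    have "dist (x, y) (0, 0) < d"
      using norm_Pair_le[of x y] that by (simp add: dist_norm zero_prod_def[symmetric])
    then show ?thesis using d(2)[of "(x, y)"] by (simp add: dist_real_def)
  qed
  then show ?case
    using d(1) by (intro exI[of _ "\<bar>G (0, 0)\<bar> + 1"] conjI exI[of _ "d / 2"]) (auto simp: fps_trunc_eval_def)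
next
  case (Suc N)
  obtain U where U: "open U" "(0, 0) \<in> U" "\<forall>k. Ck_on k G U"
    using Suc.prems by (auto simp: smooth_near_origin_def)
  then have dG: "G differentiable_on U" using Ck_on.simps(2) by blast
  obtain r where r: "r > 0" "ball (0, 0) r \<subseteq> U"
    using U(1,2) open_contains_ball by blast
  obtain C1 d1 where 1: "C1 \<ge> 0" "d1 > 0" "\<And>x y. \<bar>x\<bar> < d1 \<Longrightarrow> \<bar>y\<bar> < d1 \<Longrightarrow>
    \<bar>pd_x G (x, y) - fps_trunc_eval N (taylor_series (pd_x G)) x y\<bar> \<le> C1 * (\<bar>x\<bar> + \<bar>y\<bar>) ^ N"
    using Suc.IH[OF smooth_near_origin_pd(1)[OF Suc.prems]] by metis
  obtain C2 d2 where 2: "C2 \<ge> 0" "d2 > 0" "\<And>x y. \<bar>x\<bar> < d2 \<Longrightarrow> \<bar>y\<bar> < d2 \<Longrightarrow>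
    \<bar>pd_y G (x, y) - fps_trunc_eval N (taylor_series (pd_y G)) x y\<bar> \<le> C2 * (\<bar>x\<bar> + \<bar>y\<bar>) ^ N"
    using Suc.IH[OF smooth_near_origin_pd(2)[OF Suc.prems]] by metis
  \<comment> \<open>With \<open>r / 2\<close> the square of half-width \<open>d\<close> stays inside
    the ball of radius \<open>r\<close>.\<close>
  define d where "d = min (r / 2) (min d1 d2)"
  let ?T = "fps_trunc_eval (Suc N) (taylor_series G)"
  have in_U: "(x, y) \<in> U" if "\<bar>x\<bar> < d" "\<bar>y\<bar> < d" for x y
  proof -
    have "dist (x, y) (0, 0) < r"
      using norm_Pair_le[of x y] that by (simp add: d_def dist_norm zero_prod_def[symmetric])
    then show ?thesis using r(2) by (metis dist_commute mem_ball subsetD)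
  qed
  note Dx = DERIV_diff[OF has_field_derivative_pd(1)[OF U(1) in_U dG] has_field_derivative_fps_trunc_eval(1)[of N "taylor_series G"]]
  note Dy = DERIV_diff[OF has_field_derivative_pd(2)[OF U(1) in_U dG] has_field_derivative_fps_trunc_eval(2)[of N "taylor_series G"]]
  have "\<bar>G (x, y) - ?T x y\<bar> \<le> (C1 + C2) * (\<bar>x\<bar> + \<bar>y\<bar>) ^ Suc N" if xy: "\<bar>x\<bar> < d" "\<bar>y\<bar> < d" for x y
  proof -
    have A: "\<bar>(G (x, y) - ?T x y) - (G (0, y) - ?T 0 y)\<bar> \<le> C1 * (\<bar>x\<bar> + \<bar>y\<bar>) ^ N * \<bar>x\<bar>"
    proof (rule abs_diff_le_of_deriv_bound[OF Dx])
      fix t assume t: "\<bar>t\<bar> \<le> \<bar>x\<bar>"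
      then show "\<bar>t\<bar> < d" "\<bar>y\<bar> < d" using xy by auto
      have "C1 * (\<bar>t\<bar> + \<bar>y\<bar>) ^ N \<le> C1 * (\<bar>x\<bar> + \<bar>y\<bar>) ^ N"
        using t 1(1) by (intro mult_left_mono power_mono) auto
      then show "\<bar>pd_x G (t, y) - fps_trunc_eval N (fps_dx (taylor_series G)) t y\<bar> \<le> C1 * (\<bar>x\<bar> + \<bar>y\<bar>) ^ N"
        using 1(3)[of t y] t xy by (force simp: d_def taylor_series_pd_x[OF Suc.prems])
    qed
    have B: "\<bar>(G (0, y) - ?T 0 y) - (G (0, 0) - ?T 0 0)\<bar> \<le> C2 * (\<bar>x\<bar> + \<bar>y\<bar>) ^ N * \<bar>y\<bar>"
    proof (rule abs_diff_le_of_deriv_bound[OF Dy])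
      fix t assume t: "\<bar>t\<bar> \<le> \<bar>y\<bar>"
      then show "\<bar>0\<bar> < d" "\<bar>t\<bar> < d" using xy by auto
      have "C2 * (\<bar>0\<bar> + \<bar>t\<bar>) ^ N \<le> C2 * (\<bar>x\<bar> + \<bar>y\<bar>) ^ N"
        using t 2(1) by (intro mult_left_mono power_mono) auto
      then show "\<bar>pd_y G (0, t) - fps_trunc_eval N (fps_dy (taylor_series G)) 0 t\<bar> \<le> C2 * (\<bar>x\<bar> + \<bar>y\<bar>) ^ N"
        using 2(3)[of 0 t] 2(2) t xy by (force simp: d_def taylor_series_pd_y)
    qed
    have "?T 0 0 = (\<Sum>i<Suc N. if i = 0 then G (0, 0) else 0)"
      unfolding fps_trunc_eval_def
    proof (rule sum.cong)
      fix i assume "i \<in> {..<Suc N}"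
      have "(\<Sum>j<Suc N - i. fps_nth (fps_nth (taylor_series G) i) j * 0 ^ i * 0 ^ j) =
        (\<Sum>j<Suc N - i. if j = 0 then fps_nth (fps_nth (taylor_series G) i) 0 * 0 ^ i else 0)"
        by (rule sum.cong) auto
      also have "\<dots> = (if i = 0 then G (0, 0) else 0)"
        using \<open>i \<in> {..<Suc N}\<close> by (auto simp: taylor_series_nth)
      finally show "(\<Sum>j<Suc N - i. fps_nth (fps_nth (taylor_series G) i) j * 0 ^ i * 0 ^ j) = (if i = 0 then G (0, 0) else 0)" .
    qed simp
    then have Z: "?T 0 0 = G (0, 0)" by simp
    have "\<bar>G (x, y) - ?T x y\<bar> \<le> C1 * (\<bar>x\<bar> + \<bar>y\<bar>) ^ N * \<bar>x\<bar> + C2 * (\<bar>x\<bar> + \<bar>y\<bar>) ^ N * \<bar>y\<bar>"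
      using A B Z by linarith
    also have "\<dots> \<le> C1 * (\<bar>x\<bar> + \<bar>y\<bar>) ^ N * (\<bar>x\<bar> + \<bar>y\<bar>) + C2 * (\<bar>x\<bar> + \<bar>y\<bar>) ^ N * (\<bar>x\<bar> + \<bar>y\<bar>)"
      using 1(1) 2(1) by (intro add_mono mult_left_mono) auto
    finally show ?thesis by (simp add: algebra_simps)
  qed
  moreover have "d > 0" using r 1 2 by (simp add: d_def)
  ultimately show ?case using 1(1) 2(1) by (intro exI[of _ "C1 + C2"] conjI exI[of _ d]) auto
qed

section \<open>Asymptotic expansions along the branch\<close>

lemma tendsto_0_bigo:
  fixes f g :: "real \<Rightarrow> real"
  assumes "f \<in> O[F](g)" "(g \<longlongrightarrow> 0) F"
  shows "(f \<longlongrightarrow> 0) F"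
proof -
  obtain c where c: "\<forall>\<^sub>F x in F. norm (f x) \<le> c * norm (g x)"
    using assms(1) by (auto elim: landau_o.bigE)
  have "((\<lambda>x. c * norm (g x)) \<longlongrightarrow> 0) F"
    using assms(2) by (auto intro!: tendsto_eq_intros)
  then show ?thesis by (rule Lim_null_comparison[OF c])
qed

lemma poly_bigo_coeff_0:
  fixes r :: "real poly"
  assumes "poly r \<in> O[at 0](\<lambda>x. x ^ N)" "N > 0"
  shows "coeff r 0 = 0"
proof -
  have "((\<lambda>x::real. x ^ N) \<longlongrightarrow> 0 ^ N) (at 0)" by (intro tendsto_intros)
  then have "((\<lambda>x::real. x ^ N) \<longlongrightarrow> 0) (at 0)" using assms(2) by (simp add: power_0_left)
  then have "(poly r \<longlongrightarrow> 0) (at 0)"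
    using assms(1) tendsto_0_bigo by blast
  moreover have "(poly r \<longlongrightarrow> poly r 0) (at 0)"
    using poly_isCont[of 0 r] by (simp add: isCont_def)
  ultimately show ?thesis
    using LIM_unique by (fastforce simp: poly_0_coeff_0)
qed

text \<open>The limit at zero gives the constant coefficient; dividing by \<open>x\<close>, which is
  nonzero on the punctured neighbourhood, lowers \<open>k\<close> and \<open>N\<close>
  together.\<close>

lemma poly_bigo_imp_coeff_0:
  fixes r :: "real poly"
  assumes "poly r \<in> O[at 0](\<lambda>x. x ^ N)" "k < N"
  shows "coeff r k = 0"
  using assms
proof (induction k arbitrary: r N)
  case 0
  then show ?case by (auto intro: poly_bigo_coeff_0)
next
  case (Suc k)
  obtain M where N: "N = Suc M" "k < M" using Suc.prems(2) by (cases N) auto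
  obtain c q where r: "r = pCons c q" by (cases r) auto
  have "coeff r 0 = 0" using poly_bigo_coeff_0[OF Suc.prems(1)] N by simp
  then have "poly r = (\<lambda>x. x * poly q x)" by (auto simp: r)
  then have "(\<lambda>x. x * poly q x) \<in> O[at 0](\<lambda>x. x * x ^ M)"
    using Suc.prems(1) by (simp add: N)
  then have "poly q \<in> O[at 0](\<lambda>x. x ^ M)"
    by (subst (asm) landau_o.big.mult_cancel_left) (auto simp: eventually_at_filter)
  then show ?case using Suc.IH N by (simp add: r)
qed

text \<open>The coefficients of \<open>p\<close> from \<open>N\<close> on are left free, so that
  sums and compositions of approximating polynomials need no truncation.\<close>

definition has_expansion :: "nat \<Rightarrow> (real \<Rightarrow> real) \<Rightarrow> real fps \<Rightarrow> bool" where
  "has_expansion N u U \<longleftrightarrow>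
    (\<exists>p. (\<forall>k<N. coeff p k = fps_nth U k) \<and> (\<lambda>x. u x - poly p x) \<in> O[at 0](\<lambda>x. x ^ N))"

lemma has_expansion_unique:
  assumes "has_expansion N u U" "has_expansion N v V" "\<forall>\<^sub>F x in at 0. u x = v x" "k < N"
  shows "fps_nth U k = fps_nth V k"
proof -
  obtain p q where p: "\<And>k. k < N \<Longrightarrow> coeff p k = fps_nth U k" "(\<lambda>x. u x - poly p x) \<in> O[at 0](\<lambda>x. x ^ N)"
    and q: "\<And>k. k < N \<Longrightarrow> coeff q k = fps_nth V k" "(\<lambda>x. v x - poly q x) \<in> O[at 0](\<lambda>x. x ^ N)"
    using assms(1,2) unfolding has_expansion_def by blast
  have "(\<lambda>x. (v x - poly q x) - (u x - poly p x)) \<in> O[at 0](\<lambda>x. x ^ N)"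
    using p(2) q(2) by (rule sum_in_bigo(2)[rotated])
  moreover have "\<forall>\<^sub>F x in at 0. (v x - poly q x) - (u x - poly p x) = poly (p - q) x"
    using assms(3) by eventually_elim simp
  ultimately have "poly (p - q) \<in> O[at 0](\<lambda>x. x ^ N)"
    by (rule landau_o.big.in_cong[THEN iffD1, rotated])
  then have "coeff (p - q) k = 0" using \<open>k < N\<close> by (rule poly_bigo_imp_coeff_0)
  then show ?thesis using p(1) q(1) \<open>k < N\<close> by simp
qed

lemma has_expansion_add:
  assumes "has_expansion N u U" "has_expansion N v V"
  shows "has_expansion N (\<lambda>x. u x + v x) (U + V)"
proof -
  obtain p q where p: "\<And>k. k < N \<Longrightarrow> coeff p k = fps_nth U k" "(\<lambda>x. u x - poly p x) \<in> O[at 0](\<lambda>x. x ^ N)"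
    and q: "\<And>k. k < N \<Longrightarrow> coeff q k = fps_nth V k" "(\<lambda>x. v x - poly q x) \<in> O[at 0](\<lambda>x. x ^ N)"
    using assms(1,2) unfolding has_expansion_def by blast
  have "(\<lambda>x. (u x - poly p x) + (v x - poly q x)) \<in> O[at 0](\<lambda>x. x ^ N)"
    using p(2) q(2) by (rule sum_in_bigo(1))
  then show ?thesis
    unfolding has_expansion_def using p(1) q(1)
    by (intro exI[of _ "p + q"]) (simp add: algebra_simps)
qed

lemma has_expansion_0: "has_expansion N (\<lambda>x. 0) 0"
  unfolding has_expansion_def by (intro exI[of _ 0]) simp

lemma has_leading_term_nth:
  assumes "has_leading_term u c m" "has_expansion (Suc m) u U"
  shows "fps_nth U m = c" "k < m \<Longrightarrow> fps_nth U k = 0"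
proof -
  have 1: "has_expansion (Suc m) u (fps_const c * fps_X ^ m)"
    using assms(1) unfolding has_expansion_def has_leading_term_def
    by (intro exI[of _ "monom c m"]) (auto simp: poly_monom)
  have 2: "fps_nth U k = fps_nth (fps_const c * fps_X ^ m) k" if "k < Suc m" for k
    by (rule has_expansion_unique[OF assms(2) 1 _ that]) simp
  show "fps_nth U m = c" using 2[of m] by simp
  show "k < m \<Longrightarrow> fps_nth U k = 0" using 2[of k] by simp
qed

lemma bigo_power_mono:
  assumes "u \<in> O[at 0](\<lambda>x::real. x ^ N)" "M \<le> N"
  shows "u \<in> O[at 0](\<lambda>x::real. x ^ M)"
proof -
  have "(\<lambda>x::real. x ^ N) \<in> O[at 0](\<lambda>x. x ^ M)"
  proof (rule landau_o.bigI[of 1])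
    have "\<forall>\<^sub>F x::real in at 0. \<bar>x\<bar> < 1"
      by (auto simp: eventually_at intro!: exI[of _ 1])
    then show "\<forall>\<^sub>F x::real in at 0. norm (x ^ N) \<le> 1 * norm (x ^ M)"
      by eventually_elim (simp add: power_abs power_decreasing[OF assms(2)])
  qed simp
  then show ?thesis using assms(1) landau_o.big_trans by blast
qed

text \<open>Each further power gains a factor of order \<open>x\<close>, via
  \<open>u * (u ^ Suc j - v ^ Suc j) + (u - v) * v ^ Suc j\<close>.\<close>

lemma bigo_power_diff:
  fixes u v :: "real \<Rightarrow> real"
  assumes u: "u \<in> O[at 0](\<lambda>x. x)" and v: "v \<in> O[at 0](\<lambda>x. x)"
    and uv: "(\<lambda>x. u x - v x) \<in> O[at 0](\<lambda>x. x ^ N)"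
  shows "(\<lambda>x. u x ^ Suc j - v x ^ Suc j) \<in> O[at 0](\<lambda>x. x ^ (N + j))"
proof (induction j)
  case 0
  then show ?case using uv by simp
next
  case (Suc j)
  have v': "(\<lambda>x. v x ^ Suc j) \<in> O[at 0](\<lambda>x. x ^ Suc j)"
    using v by (rule landau_o.big_power)
  have "(\<lambda>x. u x * (u x ^ Suc j - v x ^ Suc j) + (u x - v x) * v x ^ Suc j) \<in> O[at 0](\<lambda>x. x ^ (N + Suc j))"
    using landau_o.big.mult[OF u Suc.IH] landau_o.big.mult[OF uv v']
    by (intro sum_in_bigo(1)) (simp_all add: power_add mult_ac)
  then show ?case by (simp add: algebra_simps)
qed

text \<open>Terms with \<open>j = 0\<close> cancel; a surviving term has \<open>i + j > m\<close>
  and order at least \<open>N + i + j - 1\<close>. The case \<open>m = 0\<close> serves composition,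
  \<open>m = 1\<close> the gain of one order for the branch.\<close>

lemma bigo_fps_trunc_eval_diff:
  fixes u v :: "real \<Rightarrow> real"
  assumes "u \<in> O[at 0](\<lambda>x. x)" "v \<in> O[at 0](\<lambda>x. x)" "(\<lambda>x. u x - v x) \<in> O[at 0](\<lambda>x. x ^ N)"
    and H: "\<And>i j. j > 0 \<Longrightarrow> i + j \<le> m \<Longrightarrow> fps_nth (fps_nth H i) j = 0"
  shows "(\<lambda>x. fps_trunc_eval K H x (u x) - fps_trunc_eval K H x (v x)) \<in> O[at 0](\<lambda>x. x ^ (N + m))"
proof -
  have "(\<lambda>x. fps_nth (fps_nth H i) j * x ^ i * (u x ^ j - v x ^ j)) \<in> O[at 0](\<lambda>x. x ^ (N + m))" for i j
  proof (cases "j = 0 \<or> i + j \<le> m")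
    case False
    then obtain l where j: "j = Suc l" by (cases j) auto
    have "(\<lambda>x. fps_nth (fps_nth H i) j * x ^ i) \<in> O[at 0](\<lambda>x::real. x ^ i)"
      by simp
    from landau_o.big.mult[OF this bigo_power_diff[OF assms(1-3), of l]]
    have "(\<lambda>x. fps_nth (fps_nth H i) j * x ^ i * (u x ^ j - v x ^ j)) \<in> O[at 0](\<lambda>x. x ^ (i + (N + l)))"
      by (simp add: j power_add)
    then show ?thesis by (rule bigo_power_mono) (use False j in simp)
  qed (use H in \<open>cases "j = 0"; simp\<close>)
  then have "(\<lambda>x. \<Sum>i<K. \<Sum>j<K-i. fps_nth (fps_nth H i) j * x ^ i * (u x ^ j - v x ^ j)) \<in> O[at 0](\<lambda>x. x ^ (N + m))"
    by (intro big_sum_in_bigo)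
  then show ?thesis
    by (simp add: fps_trunc_eval_def sum_subtractf algebra_simps)
qed

lemma taylor_remainder_bigo:
  assumes G: "smooth_near_origin G" and u: "u \<in> O[at 0](\<lambda>x. x)"
  shows "(\<lambda>x. G (x, u x) - fps_trunc_eval N (taylor_series G) x (u x)) \<in> O[at 0](\<lambda>x. x ^ N)"
proof -
  obtain C d where C: "C \<ge> 0" "d > 0" "\<And>x y. \<bar>x\<bar> < d \<Longrightarrow> \<bar>y\<bar> < d \<Longrightarrow>
    \<bar>G (x, y) - fps_trunc_eval N (taylor_series G) x y\<bar> \<le> C * (\<bar>x\<bar> + \<bar>y\<bar>) ^ N"
    using taylor_remainder_bound[OF G, of N] by metis
  have "(u \<longlongrightarrow> 0) (at 0)"
    using u by (rule tendsto_0_bigo) (rule tendsto_ident_at)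
  then have "\<forall>\<^sub>F x in at 0. \<bar>u x\<bar> < d"
    using C(2) by (auto simp: tendsto_iff)
  moreover have "\<forall>\<^sub>F x::real in at 0. \<bar>x\<bar> < d"
    using C(2) by (auto simp: eventually_at)
  ultimately have "\<forall>\<^sub>F x in at 0. norm (G (x, u x) - fps_trunc_eval N (taylor_series G) x (u x))
      \<le> C * norm ((\<bar>x\<bar> + \<bar>u x\<bar>) ^ N)"
  proof eventually_elim
    case (elim x)
    have "norm ((\<bar>x\<bar> + \<bar>u x\<bar>) ^ N) = (\<bar>x\<bar> + \<bar>u x\<bar>) ^ N"
      by (simp add: power_abs)
    then show ?case using C(3)[OF elim(2,1)] by (simp only: real_norm_def)
  qed
  then have "(\<lambda>x. G (x, u x) - fps_trunc_eval N (taylor_series G) x (u x)) \<in> O[at 0](\<lambda>x. (\<bar>x\<bar> + \<bar>u x\<bar>) ^ N)"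
    by (rule bigoI)
  also have "(\<lambda>x. (\<bar>x\<bar> + \<bar>u x\<bar>) ^ N) \<in> O[at 0](\<lambda>x. x ^ N)"
    using u by (intro landau_o.big_power sum_in_bigo(1)) simp_all
  finally show ?thesis .
qed

definition fps_trunc_poly :: "nat \<Rightarrow> real fps fps \<Rightarrow> real poly \<Rightarrow> real poly" where
  "fps_trunc_poly N H p = (\<Sum>i<N. \<Sum>j<N-i. smult (fps_nth (fps_nth H i) j) (monom 1 i * p ^ j))"

lemma poly_fps_trunc_poly: "poly (fps_trunc_poly N H p) x = fps_trunc_eval N H x (poly p x)"
  by (simp add: fps_trunc_poly_def fps_trunc_eval_def poly_sum poly_monom mult.assoc)

lemma coeff_power_eq_fps_nth_power:
  fixes p :: "real poly"
  assumes "\<And>k. k < N \<Longrightarrow> coeff p k = fps_nth U k"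
  shows "k < N \<Longrightarrow> coeff (p ^ j) k = fps_nth (U ^ j) k"
proof (induction j arbitrary: k)
  case (Suc j)
  have "(\<Sum>i\<le>k. coeff p i * coeff (p ^ j) (k - i)) = (\<Sum>i\<le>k. fps_nth U i * fps_nth (U ^ j) (k - i))"
  proof (rule sum.cong[OF refl], rule arg_cong2[where f = "(*)"])
    fix i assume "i \<in> {..k}"
    with Suc.prems have "i < N" "k - i < N" by auto
    then show "coeff p i = fps_nth U i" "coeff (p ^ j) (k - i) = fps_nth (U ^ j) (k - i)"
      by (blast intro: assms, blast intro: Suc.IH)
  qed
  then show ?case
    by (simp only: power_Suc coeff_mult fps_mult_nth atLeast0AtMost)
qed simp

text \<open>As \<open>\<phi> ^ j\<close> has order at least \<open>j\<close>, terms of total degree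
  \<open>N\<close> or more cannot reach a coefficient of index below \<open>N\<close>.\<close>

lemma coeff_fps_trunc_poly:
  assumes p: "\<And>k. k < N \<Longrightarrow> coeff p k = fps_nth \<phi> k" and \<phi>: "fps_nth \<phi> 0 = 0" and k: "k < N"
  shows "coeff (fps_trunc_poly N H p) k = fps_nth (fps_subst H \<phi>) k"
proof -
  have "coeff (fps_trunc_poly N H p) k = (\<Sum>i<N. \<Sum>j<N-i. if k < i then 0 else fps_nth (fps_nth H i) j * fps_nth (\<phi> ^ j) (k - i))"
    unfolding fps_trunc_poly_def coeff_sum coeff_smult coeff_monom_mult
  proof (intro sum.cong refl)
    fix i j
    have "coeff (p ^ j) (k - i) = fps_nth (\<phi> ^ j) (k - i)"
      using k by (intro coeff_power_eq_fps_nth_power[OF p]) auto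
    then show "fps_nth (fps_nth H i) j * (if k < i then 0 else 1 * coeff (p ^ j) (k - i))
        = (if k < i then 0 else fps_nth (fps_nth H i) j * fps_nth (\<phi> ^ j) (k - i))"
      by simp
  qed
  also have "\<dots> = (\<Sum>i\<le>k. \<Sum>j<N-i. fps_nth (fps_nth H i) j * fps_nth (\<phi> ^ j) (k - i))"
    using k by (intro sum.mono_neutral_cong_right) auto
  also have "\<dots> = (\<Sum>i\<le>k. \<Sum>j\<le>k-i. fps_nth (fps_nth H i) j * fps_nth (\<phi> ^ j) (k - i))"
  proof (rule sum.cong[OF refl], rule sum.mono_neutral_right)
    fix i assume "i \<in> {..k}"
    with k show "{..k - i} \<subseteq> {..<N - i}" by auto
    show "\<forall>j\<in>{..<N - i} - {..k - i}. fps_nth (fps_nth H i) j * fps_nth (\<phi> ^ j) (k - i) = 0"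
      using startsby_zero_power_prefix[OF \<phi>] by simp
  qed simp
  finally show ?thesis by (simp add: fps_subst_nth)
qed

text \<open>\<open>G\<close> is replaced by its Taylor polynomial and then \<open>u\<close> by
  \<open>p\<close>, each with error of order \<open>N\<close>. For \<open>N = 0\<close> the
  polynomial \<open>p\<close> need not vanish at zero, hence the separate case.\<close>

lemma has_expansion_compose:
  assumes G: "smooth_near_origin G" and u: "u \<in> O[at 0](\<lambda>x. x)" and "has_expansion N u \<phi>" "fps_nth \<phi> 0 = 0"
  shows "has_expansion N (\<lambda>x. G (x, u x)) (fps_subst (taylor_series G) \<phi>)"
proof (cases "N = 0")
  case True
  have "(\<lambda>x. G (x, u x)) \<in> O[at 0](\<lambda>x. x ^ 0)"
    using taylor_remainder_bigo[OF G u, of 0] by (simp add: fps_trunc_eval_def)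
  then show ?thesis
    unfolding has_expansion_def by (intro exI[of _ 0]) (simp add: True)
next
  case False
  obtain p where p: "\<And>k. k < N \<Longrightarrow> coeff p k = fps_nth \<phi> k" "(\<lambda>x. u x - poly p x) \<in> O[at 0](\<lambda>x. x ^ N)"
    using assms(3) unfolding has_expansion_def by blast
  have "(\<lambda>x. u x - poly p x) \<in> O[at 0](\<lambda>x. x)"
    using bigo_power_mono[OF p(2), of 1] False by simp
  from sum_in_bigo(2)[OF u this] have v: "poly p \<in> O[at 0](\<lambda>x. x)" by simp
  let ?T = "fps_trunc_eval N (taylor_series G)"
  have "(\<lambda>x. (G (x, u x) - ?T x (u x)) + (?T x (u x) - ?T x (poly p x))) \<in> O[at 0](\<lambda>x. x ^ N)"
    using taylor_remainder_bigo[OF G u, of N] bigo_fps_trunc_eval_diff[OF u v p(2), of 0 "taylor_series G" N]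
    by (intro sum_in_bigo(1)) simp_all
  then show ?thesis
    unfolding has_expansion_def using coeff_fps_trunc_poly[OF p(1) assms(4)]
    by (intro exI[of _ "fps_trunc_poly N (taylor_series G) p"]) (simp add: poly_fps_trunc_poly)
qed

section \<open>Taylor series of the branch and conclusion\<close>

text \<open>\<open>P\<close> is quadratically small, so near zero \<open>\<bar>F x\<bar>\<close> is
  at most half of \<open>\<bar>x\<bar> + \<bar>F x\<bar>\<close>, and the \<open>F\<close> term is
  absorbed on the left.\<close>

lemma nullcline_branch_bigo:
  assumes P: "smooth_near_origin P"
    and P1: "\<And>i j. i + j \<le> 1 \<Longrightarrow> fps_nth (fps_nth (taylor_series P) i) j = 0"
    and F: "nullcline_branch P F"
  shows "F \<in> O[at 0](\<lambda>x. x)"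
proof (rule landau_o.bigI[of 1])
  have 0: "fps_trunc_eval 2 (taylor_series P) x y = 0" for x y
    unfolding fps_trunc_eval_def
  proof (intro sum.neutral ballI)
    fix i j :: nat assume "i \<in> {..<2}" "j \<in> {..<2 - i}"
    then have "i + j \<le> 1" by auto
    then show "fps_nth (fps_nth (taylor_series P) i) j * x ^ i * y ^ j = 0" by (simp only: P1 mult_zero_left)
  qed
  obtain C d where C: "C \<ge> 0" "d > 0" "\<And>x y. \<bar>x\<bar> < d \<Longrightarrow> \<bar>y\<bar> < d \<Longrightarrow> \<bar>P (x, y)\<bar> \<le> C * (\<bar>x\<bar> + \<bar>y\<bar>) ^ 2"
    using taylor_remainder_bound[OF P, of 2] unfolding 0 diff_zero by blast
  \<comment> \<open>Chosen so that \<open>C * (2 * e)\<close> is at most one half;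
    \<open>C + 1\<close> avoids a zero denominator.\<close>
  define e where "e = min d (1 / (4 * (C + 1)))"
  have e: "e > 0" "e \<le> d" "4 * (C * e) \<le> 1"
  proof -
    have "4 * (C * e) \<le> 4 * ((C + 1) * (1 / (4 * (C + 1))))"
      using C(1) by (intro mult_left_mono mult_mono) (auto simp: e_def C(2) less_imp_le)
    then show "4 * (C * e) \<le> 1" using C(1) by simp
  qed (use C in \<open>auto simp: e_def\<close>)
  have "(F \<longlongrightarrow> 0) (at 0)" "\<forall>\<^sub>F x in at 0. F x + P (x, F x) = 0"
    using F by (auto simp: nullcline_branch_def isCont_def eventually_nhds_conv_at)
  then have "\<forall>\<^sub>F x in at 0. \<bar>F x\<bar> < e" "\<forall>\<^sub>F x in at 0. F x + P (x, F x) = 0"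
    using e(1) by (auto simp: tendsto_iff)
  moreover have "\<forall>\<^sub>F x::real in at 0. \<bar>x\<bar> < e"
    using e(1) by (auto simp: eventually_at)
  ultimately show "\<forall>\<^sub>F x in at 0. norm (F x) \<le> 1 * norm x"
  proof eventually_elim
    case (elim x)
    let ?s = "\<bar>x\<bar> + \<bar>F x\<bar>"
    have "\<bar>F x\<bar> \<le> C * ?s ^ 2"
      using C(3)[of x "F x"] elim e(2) by (simp add: add_eq_0_iff)
    also have "\<dots> \<le> C * (2 * e) * ?s"
    proof -
      have "?s * ?s \<le> (2 * e) * ?s"
        using elim by (intro mult_right_mono) auto
      from mult_left_mono[OF this C(1)] show ?thesis
        by (simp only: power2_eq_square mult.assoc)
    qed
    also have "\<dots> \<le> 1 / 2 * ?s"
      using e(3) by (intro mult_right_mono) auto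
    finally show ?case by simp
  qed
qed simp

text \<open>Since \<open>P\<close> has no terms of degree at most one, an approximation of \<open>F\<close> to order \<open>N\<close>
  determines \<open>P(x, F(x)) = - F(x)\<close> to order \<open>N + 1\<close>.\<close>

lemma nullcline_branch_expansion:
  assumes P: "smooth_near_origin P"
    and P1: "\<And>i j. i + j \<le> 1 \<Longrightarrow> fps_nth (fps_nth (taylor_series P) i) j = 0"
    and F: "nullcline_branch P F"
  obtains \<phi> where "\<And>N. has_expansion N F \<phi>"
proof -
  let ?T = "\<lambda>N. fps_trunc_eval N (taylor_series P)"
  note FO = nullcline_branch_bigo[OF assms]
  have "\<exists>p. (\<lambda>x. F x - poly p x) \<in> O[at 0](\<lambda>x. x ^ Suc N)" for N
  proof (induction N)
    case 0
    then show ?case using FO by (intro exI[of _ 0]) simp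
  next
    case (Suc N)
    then obtain p where p: "(\<lambda>x. F x - poly p x) \<in> O[at 0](\<lambda>x. x ^ Suc N)" by blast
    have "(\<lambda>x. F x - poly p x) \<in> O[at 0](\<lambda>x. x)"
      using bigo_power_mono[OF p, of 1] by simp
    from sum_in_bigo(2)[OF FO this] have v: "poly p \<in> O[at 0](\<lambda>x. x)" by simp
    let ?M = "Suc (Suc N)"
    have "(\<lambda>x. ?T ?M x (F x) - ?T ?M x (poly p x)) \<in> O[at 0](\<lambda>x. x ^ ?M)"
      using bigo_fps_trunc_eval_diff[OF FO v p P1, of 1 ?M] by simp
    moreover have "(\<lambda>x. - (P (x, F x) - ?T ?M x (F x))) \<in> O[at 0](\<lambda>x. x ^ ?M)"
      by (subst landau_o.big.uminus_in_iff) (rule taylor_remainder_bigo[OF P FO])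
    ultimately have "(\<lambda>x. - (P (x, F x) - ?T ?M x (F x)) - (?T ?M x (F x) - ?T ?M x (poly p x))) \<in> O[at 0](\<lambda>x. x ^ ?M)"
      by (rule sum_in_bigo(2)[rotated])
    moreover have "\<forall>\<^sub>F x in at 0. F x + P (x, F x) = 0"
      using F by (auto simp: nullcline_branch_def eventually_nhds_conv_at)
    \<comment> \<open>The branch equation \<open>F x = - P (x, F x)\<close> makes the next
      approximation the truncation of \<open>- P\<close> evaluated at the current one.\<close>
    then have "\<forall>\<^sub>F x in at 0. - (P (x, F x) - ?T ?M x (F x)) - (?T ?M x (F x) - ?T ?M x (poly p x))
        = F x - poly (- fps_trunc_poly ?M (taylor_series P) p) x"
      by eventually_elim (simp add: poly_fps_trunc_poly)
    ultimately have "(\<lambda>x. F x - poly (- fps_trunc_poly ?M (taylor_series P) p) x) \<in> O[at 0](\<lambda>x. x ^ ?M)"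
      by (rule landau_o.big.in_cong[THEN iffD1, rotated])
    then show ?case by blast
  qed
  then obtain p where p: "\<And>N. (\<lambda>x. F x - poly (p N) x) \<in> O[at 0](\<lambda>x. x ^ Suc N)"
    by metis
  \<comment> \<open>Diagonal choice: by \<open>stable\<close>, the coefficient of index
    \<open>k\<close> no longer changes from the approximation \<open>p k\<close> on.\<close>
  define \<phi> where "\<phi> = Abs_fps (\<lambda>k. coeff (p k) k)"
  have stable: "coeff (p N) k = coeff (p k) k" if "k \<le> N" for k N
  proof -
    have "(\<lambda>x. F x - poly (p N) x) \<in> O[at 0](\<lambda>x. x ^ Suc k)"
      by (rule bigo_power_mono[OF p]) (use that in simp)
    moreover have "(\<lambda>x. (F x - poly (p k) x) - (F x - poly (p N) x)) = poly (p N - p k)"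
      by (simp add: fun_eq_iff)
    ultimately have "poly (p N - p k) \<in> O[at 0](\<lambda>x. x ^ Suc k)"
      using sum_in_bigo(2)[OF p[of k]] by metis
    then have "coeff (p N - p k) k = 0" by (rule poly_bigo_imp_coeff_0) simp
    then show ?thesis by simp
  qed
  have "\<forall>k<N. coeff (p N) k = fps_nth \<phi> k" for N
    unfolding \<phi>_def fps_nth_Abs_fps by (intro allI impI stable less_imp_le)
  moreover have "(\<lambda>x. F x - poly (p N) x) \<in> O[at 0](\<lambda>x. x ^ N)" for N
    by (rule bigo_power_mono[OF p]) simp
  ultimately have "has_expansion N F \<phi>" for N
    unfolding has_expansion_def by blast
  then show thesis by (rule that)
qed

theorem proposition33:
  fixes P Q :: "real \<times> real \<Rightarrow> real"
  assumes "smooth_near_origin P" and "smooth_near_origin Q"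
    and "jet 1 P = 0" and "jet 1 Q = 0"
    and "isolated_singular_origin (nilp_field P Q)"
    and "monodromic_origin (nilp_field P Q)"
    and "andreev_condition_ii P Q"
  shows "\<not> (\<exists>H. formal_first_integral P Q H)"
proof
  assume "\<exists>H. formal_first_integral P Q H"
  then obtain H where Hc: "\<And>c. H \<noteq> fps_const (fps_const c)"
    and H: "(fps_y + taylor_series P) * fps_dx H + taylor_series Q * fps_dy H = 0"
    by (auto simp: formal_first_integral_def)
  obtain F a b \<alpha> \<beta> n where F: "nullcline_branch P F"
    and a: "has_leading_term (\<lambda>x. Q (x, F x)) a \<alpha>"
    and b: "has_leading_term (divergence_along P Q F) b \<beta>"
    and n: "n \<ge> 1" "\<alpha> = 2 * n - 1" "\<beta> = n - 1" and disc: "b\<^sup>2 + 4 * a * real n < 0"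
    using assms(7) unfolding andreev_condition_ii_def by blast
  have P1: "fps_nth (fps_nth (taylor_series P) i) j = 0" if "i + j \<le> 1" for i j
  proof -
    have "fps_nth (fps_nth (jet 1 P) i) j = 0" using assms(3) by simp
    then show ?thesis using that by (simp add: jet_def)
  qed
  note FO = nullcline_branch_bigo[OF assms(1) P1 F]
  obtain \<phi> where \<phi>: "\<And>N. has_expansion N F \<phi>"
    using nullcline_branch_expansion[OF assms(1) P1 F] by blast
  have \<phi>0: "fps_nth \<phi> 0 = 0"
  proof -
    have "has_expansion 1 F 0" unfolding has_expansion_def using FO by (intro exI[of _ 0]) simp
    from has_expansion_unique[OF \<phi> this, of 0] show ?thesis by simp
  qed
  note comp = has_expansion_compose[OF _ FO \<phi> \<phi>0]
  \<comment> \<open>Expansions are unique, so an identity of germs becomes one of series, checked at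
    index \<open>k\<close> with order \<open>Suc k\<close>.\<close>
  have "\<phi> + fps_subst (taylor_series P) \<phi> = 0"
  proof (rule fps_ext)
    fix k
    have "\<forall>\<^sub>F x in at 0. F x + P (x, F x) = 0"
      using F by (auto simp: nullcline_branch_def eventually_nhds_conv_at)
    from has_expansion_unique[OF has_expansion_add[OF \<phi> comp[OF assms(1)]] has_expansion_0 this, of k "Suc k"]
    show "fps_nth (\<phi> + fps_subst (taylor_series P) \<phi>) k = fps_nth 0 k" by simp
  qed
  moreover have "has_expansion N (divergence_along P Q F)
      (fps_subst (fps_dx (taylor_series P) + fps_dy (taylor_series Q)) \<phi>)" for N
    using has_expansion_add[OF comp[OF smooth_near_origin_pd(1)[OF assms(1)]] comp[OF smooth_near_origin_pd(2)[OF assms(2)]], of N]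
    by (simp add: divergence_along_def[abs_def] fps_subst_add taylor_series_pd_x[OF assms(1)] taylor_series_pd_y)
  note div = has_leading_term_nth[OF b this, unfolded n]
  note f = has_leading_term_nth[OF a comp[OF assms(2)], unfolded n]
  have "b \<noteq> 0" using b by (simp add: has_leading_term_def)
  ultimately have "H = fps_const (fps_const (fps_nth (fps_nth H 0) 0))"
    using P1[of 0 1] by (intro formal_first_integral_imp_const[OF \<phi>0 _ _ n(1) f(2,1) div(2,1) _ disc H]) simp_all
  then show False using Hc by blast
qed

end
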